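(* Let $n,m$ be two positive integers. Then for every real number $\epsilon>0$ and every integer $k\geqslant 1$, $\mathbb{Z}^n$ is $\left(\varpi^{(k)}_{m/n,\epsilon},\varpi^{(k)}_{n/m,\epsilon}\right)$-orbit equivalent (and hence $\left(\varpi^{(k)}_{m/n,\epsilon},\varpi^{(k)}_{n/m,\epsilon}\right)$-measure equivalent) to $\mathbb{Z}^m$.
   Context: **Functions.** $\log^{(1)}(t)=\log t$, $\log^{(j+1)}(t)=\log(\log^{(j)}(t))$ for $t$ sufficiently large, and $\Lambda_k(t)=\prod_{j=1}^k\log^{(j)}(t)$. For real $\alpha>0$, $\epsilon>0$ and an integer $k\geqslant 1$, fix $T=T_{\alpha,k,\epsilon}>0$ with $\log^{(k)}(T)$ defined and positive such that $t\mapsto (t^\alpha/\Lambda_k(t))\cdot(\log^{(k)}t)^{-\epsilon}$ is continuous, positive and increasing on $[T,+\infty)$ (such $T$ exists). Define $\varpi^{(k)}_{\alpha,\epsilon}:\mathbb{R}_{\geqslant 0}\to\mathbb{R}$ to be equal to $(t^\alpha/\Lambda_k(t))\cdot(\log^{(k)}t)^{-\epsilon}$ for $t\geqslant T$, and equal to the constant $(T^\alpha/\Lambda_k(T))\cdot(\log^{(k)}T)^{-\epsilon}$ for $0\leqslant t<T$. **Orbit equivalence.** A p.m.p. action is a measurable, measure-preserving action of a countable group on a standard probability space; it is (essentially) free if for a.e. $x$ one has $gx\neq x$ for all $g\neq e$. An orbit equivalence from a p.m.p. action $G\curvearrowright(X,\mu)$ to a p.m.p. action $H\curvearrowright(Y,\nu)$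 is a measure isomorphism $\Phi:X\to Y$ with $\Phi(Gx)=H\Phi(x)$ for $\mu$-a.e. $x\in X$. When both actions are free, its cocycle $\kappa^\Phi:G\times X\to H$ is determined (for a.e. $x$) by $\Phi(gx)=\kappa^\Phi(g,x)\Phi(x)$ for all $g\in G$. For $\omega:\mathbb{R}_{\geqslant 0}\to\mathbb{R}_{\geqslant 0}$ non-decreasing, $G,H$ finitely generated, $|\cdot|_H$ a word length on $H$ (for $\mathbb{Z}^d$: the sum of absolute values of coordinates), $\Phi$ is $\omega$-integrable if for every $g\in G$ there is $c_g>0$ with $\int_X\omega(|\kappa^\Phi(g,x)|_H/c_g)\,\mathrm{d}\mu(x)<\infty$. $\Phi$ is $(\omega_1,\omega_2)$-integrable if $\Phi$ is $\omega_1$-integrable and $\Phi^{-1}$ is $\omega_2$-integrable. $G$ is $(\omega_1,\omega_2)$-orbit equivalent to $H$ if there is an $(\omega_1,\omega_2)$-integrable orbit equivalence from some free p.m.p. $G$-action to some free p.m.p. $H$-action. **Measure equivalence.** A standard measure space is a standard Borel space with a non-zero $\sigma$-finite measure. A fundamental domain of an action $G\curvearrowright(X,\mu)$ is a Borel set $X_G\subset X$ with $|X_G\cap Gx|=1$ for $\mu$-a.e. $x$. A measure equivalence coupling from $G$ to $H$ is $\mathcal{C}=(X,X_G,X_H,\mu)$ where $(X,\mu)$ is a standard measure space with free measure-preserving actions of $G$ and $H$ that commute (almost everywhere), $X_G,X_H$ are fundamental domains for the $G$- and $H$-actions respectively, and $\mu(X_G),\mu(X_H)<\infty$. The induced action of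 $G$ on $X_H$ is given by $\{g\star x\}=X_H\cap H(gx)$, and the cocycle $\kappa^{\mathcal{C}}:G\times X_H\to H$ by $\kappa^{\mathcal{C}}(g,x)(gx)=g\star x$ (for a.e. $x\in X_H$ and all $g\in G$). $\mathcal{C}$ is $\omega$-integrable if for every $g\in G$ there is $c_g>0$ with $\int_{X_H}\omega(|\kappa^{\mathcal{C}}(g,x)|_H/c_g)\,\mathrm{d}\mu(x)<\infty$. With $\mathcal{C}^{-1}=(X,X_H,X_G,\mu)$ (a coupling from $H$ to $G$), $\mathcal{C}$ is $(\omega_1,\omega_2)$-integrable if $\mathcal{C}$ is $\omega_1$-integrable and $\mathcal{C}^{-1}$ is $\omega_2$-integrable; $G$ is $(\omega_1,\omega_2)$-measure equivalent to $H$ if such a coupling from $G$ to $H$ exists. *)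

theory Defs
  imports "HOL-Probability.Probability" "HOL-Algebra.Group_Action"
    "HOL-Algebra.Product_Groups" "HOL-Algebra.Elementary_Groups"
begin

section \<open>Integrability functions\<close>

definition ilog :: "nat \<Rightarrow> real \<Rightarrow> real" where
  "ilog j t = (ln ^^ j) t"

definition Lambda :: "nat \<Rightarrow> real \<Rightarrow> real" where
  "Lambda k t = (\<Prod>j=1..k. ilog j t)"

definition varpi_formula :: "real \<Rightarrow> nat \<Rightarrow> real \<Rightarrow> real \<Rightarrow> real" where
  "varpi_formula \<alpha> k \<epsilon> t = (t powr \<alpha> / Lambda k t) * ilog k t powr (- \<epsilon>)"

text \<open>The library's \<open>ln\<close> is total, so an iterated logarithm at \<open>T\<close> is meaningful only if all the
  preceding ones are positive; the first condition says that the \<open>k\<close>-th one is defined and positive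
  (and, for \<open>j = 0\<close>, that \<open>T > 0\<close>).\<close>

definition admissible_threshold :: "real \<Rightarrow> nat \<Rightarrow> real \<Rightarrow> real \<Rightarrow> bool" where
  "admissible_threshold \<alpha> k \<epsilon> T \<longleftrightarrow>
     (\<forall>j\<le>k. ilog j T > 0) \<and>
     continuous_on {T..} (varpi_formula \<alpha> k \<epsilon>) \<and>
     (\<forall>t\<ge>T. varpi_formula \<alpha> k \<epsilon> t > 0) \<and>
     strict_mono_on {T..} (varpi_formula \<alpha> k \<epsilon>)"

text \<open>Only the values at arguments \<open>t \<ge> 0\<close> matter.\<close>

definition varpi :: "real \<Rightarrow> real \<Rightarrow> nat \<Rightarrow> real \<Rightarrow> real \<Rightarrow> real" where
  "varpi T \<alpha> k \<epsilon> t = (if t \<ge> T then varpi_formula \<alpha> k \<epsilon> t else varpi_formula \<alpha> k \<epsilon> T)"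

lemma ilog_0 [simp]: "ilog 0 t = t"
  by (simp add: ilog_def)

lemma ilog_Suc: "ilog (Suc j) t = ilog j (ln t)"
  by (simp add: ilog_def funpow_swap1)

lemma Lambda_Suc: "Lambda (Suc k) t = ln t * Lambda k (ln t)"
proof (induction k)
  case 0
  show ?case by (simp add: Lambda_def ilog_def)
next
  case (Suc k)
  have "Lambda (Suc (Suc k)) t = Lambda (Suc k) t * ilog (Suc (Suc k)) t"
    by (simp add: Lambda_def)
  also have "\<dots> = ln t * (Lambda k (ln t) * ilog (Suc k) (ln t))"
    by (simp only: Suc.IH ilog_Suc[of "Suc k" t] mult.assoc)
  also have "Lambda k (ln t) * ilog (Suc k) (ln t) = Lambda (Suc k) (ln t)"
    by (simp add: Lambda_def)
  finally show ?case .
qed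

lemma powr_ln_strict_mono:
  assumes a: "\<alpha> > 0" and c: "c > (0::real)"
  shows "strict_mono_on {exp (c / \<alpha> + 1)..} (\<lambda>t. t powr \<alpha> * ln t powr (- c))"
proof (rule strict_mono_onI)
  fix x y :: real
  assume "x \<in> {exp (c / \<alpha> + 1)..}" and xy: "x < y"
  then have ex: "exp (c / \<alpha> + 1) \<le> x" by simp
  have xp: "x > 0" "y > 0"
    using ex xy exp_gt_zero[of "c / \<alpha> + 1"] by linarith+
  have s0: "ln x \<ge> c / \<alpha> + 1" using ex xp by (simp add: ln_ge_iff)
  have lt: "ln x < ln y" using xy xp by simp
  have "c / \<alpha> > 0" using a c by simp
  then have sp: "ln x > 0" "ln y > 0" "ln x > c / \<alpha>" using s0 lt by auto
  have "ln (ln y) - ln (ln x) \<le> ln y / ln x - 1"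
    using ln_le_minus_one[of "ln y / ln x"] sp by (simp add: ln_div)
  also have "\<dots> = (ln y - ln x) / ln x" using sp by (simp add: field_simps)
  also have "\<dots> < (ln y - ln x) / (c / \<alpha>)"
    using sp lt \<open>c / \<alpha> > 0\<close> by (intro divide_strict_left_mono mult_pos_pos) linarith+
  finally have "c * (ln (ln y) - ln (ln x)) < \<alpha> * (ln y - ln x)"
    using a c by (simp add: field_simps)
  then show "x powr \<alpha> * ln x powr (- c) < y powr \<alpha> * ln y powr (- c)"
    using xp sp by (simp add: powr_def flip: exp_add) (simp add: algebra_simps)
qed

lemma varpi_formula_1:
  assumes "t > 1"
  shows "varpi_formula \<alpha> 1 \<epsilon> t = t powr \<alpha> * ln t powr (- (1 + \<epsilon>))"
proof -
  have "ln t powr (- (1 + \<epsilon>)) = inverse (ln t) * ln t powr (- \<epsilon>)"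
    using assms powr_add[of "ln t" "- 1" "- \<epsilon>"] by (simp add: powr_minus)
  then show ?thesis
    by (simp add: varpi_formula_def Lambda_def ilog_def divide_inverse)
qed

lemma varpi_formula_Suc:
  assumes "t > 1"
  shows "varpi_formula \<alpha> (Suc k) \<epsilon> t = (t powr \<alpha> * ln t powr (- 2)) * varpi_formula 1 k \<epsilon> (ln t)"
proof -
  have "ln t powr (- 2) * ln t = inverse (ln t)"
    using assms powr_add[of "ln t" "- 2" 1] by (simp add: powr_minus)
  then have *: "inverse (ln t) = ln t powr (- 2) * ln t" ..
  have "varpi_formula \<alpha> (Suc k) \<epsilon> t =
      t powr \<alpha> * (inverse (ln t) * inverse (Lambda k (ln t))) * ilog k (ln t) powr (- \<epsilon>)"
    by (simp only: varpi_formula_def Lambda_Suc ilog_Suc divide_inverse inverse_mult_distrib)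
  also have "\<dots> = (t powr \<alpha> * ln t powr (- 2)) *
      (ln t * inverse (Lambda k (ln t)) * ilog k (ln t) powr (- \<epsilon>))"
    by (simp only: * mult.assoc)
  also have "ln t * inverse (Lambda k (ln t)) * ilog k (ln t) powr (- \<epsilon>) =
      varpi_formula 1 k \<epsilon> (ln t)"
    using assms by (simp only: varpi_formula_def divide_inverse powr_one ln_ge_zero less_imp_le)
  finally show ?thesis .
qed

lemma exists_admissible_threshold:
  assumes "\<alpha> > 0" "k \<ge> 1" "\<epsilon> > 0"
  shows "\<exists>T. admissible_threshold \<alpha> k \<epsilon> T"
  using assms(2,1,3)
proof (induction k arbitrary: \<alpha> rule: dec_induct)
  case base
  define T where "T = exp ((1 + \<epsilon>) / \<alpha> + 1)"
  have "(1 + \<epsilon>) / \<alpha> > 0" using base by (intro divide_pos_pos) linarith+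
  then have "(1 + \<epsilon>) / \<alpha> + 1 > 0" by linarith
  then have T: "T > 1" unfolding T_def by (simp only: one_less_exp_iff)
  have sm: "strict_mono_on {T..} (\<lambda>t. t powr \<alpha> * ln t powr (- (1 + \<epsilon>)))"
    unfolding T_def by (rule powr_ln_strict_mono) (use base in auto)
  have eq: "varpi_formula \<alpha> 1 \<epsilon> t = t powr \<alpha> * ln t powr (- (1 + \<epsilon>))" if "t \<ge> T" for t
    using that T by (intro varpi_formula_1) auto
  have "continuous_on {T..} (\<lambda>t. t powr \<alpha> * ln t powr (- (1 + \<epsilon>)))"
    using T by (intro continuous_intros) auto
  then have "continuous_on {T..} (varpi_formula \<alpha> 1 \<epsilon>)"
    by (subst continuous_on_cong[OF refl eq]) auto
  moreover have "strict_mono_on {T..} (varpi_formula \<alpha> 1 \<epsilon>)"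
    using sm eq by (auto simp: strict_mono_on_def)
  moreover have "\<forall>t\<ge>T. varpi_formula \<alpha> 1 \<epsilon> t > 0"
    using eq T by auto
  moreover have "ilog j T > 0" if "j \<le> 1" for j
    using that T by (cases j) (auto simp: ilog_Suc)
  ultimately show ?case unfolding admissible_threshold_def by blast
next
  case (step k)
  from step.IH[of 1] step.prems obtain S where S: "admissible_threshold 1 k \<epsilon> S" by auto
  have S0: "S > 0" using S by (auto simp: admissible_threshold_def dest: spec[of _ 0])
  define g where "g = (\<lambda>t::real. t powr \<alpha> * ln t powr (- 2))"
  define f where "f = varpi_formula 1 k \<epsilon>"
  obtain T where T: "T = exp (max S (2 / \<alpha> + 1))" by blast
  have lnT: "ln T \<ge> S" "ln T > 0" and T1: "T > 1" using S0 by (auto simp: T)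
  have ge: "T \<ge> exp (2 / \<alpha> + 1)" by (simp add: T)
  have lnt: "ln t \<ge> S" "ln t > 0" "t > 1" if "t \<ge> T" for t
  proof -
    show "t > 1" using that T1 by simp
    have "ln t \<ge> ln T" using that T1 by simp
    then show "ln t \<ge> S" "ln t > 0" using lnT by auto
  qed
  have eq: "varpi_formula \<alpha> (Suc k) \<epsilon> t = g t * f (ln t)" if "t \<ge> T" for t
    unfolding g_def f_def using lnt[OF that] by (intro varpi_formula_Suc)
  have fpos: "f s > 0" if "s \<ge> S" for s
    using S that by (auto simp: admissible_threshold_def f_def)
  have fmono: "strict_mono_on {S..} f"
    using S by (auto simp: admissible_threshold_def f_def)
  have fcont: "continuous_on {S..} f"
    using S by (auto simp: admissible_threshold_def f_def)
  have gpos: "g t > 0" if "t \<ge> T" for t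
    using lnt[OF that] by (auto simp: g_def)
  have gmono: "strict_mono_on {T..} g"
    using powr_ln_strict_mono[of \<alpha> 2] step.prems ge
    by (auto simp: g_def strict_mono_on_def)
  have "continuous_on {T..} g"
    unfolding g_def using lnt by (intro continuous_intros) force+
  moreover have "continuous_on {T..} (\<lambda>t. f (ln t))"
    by (rule continuous_on_compose2[OF fcont]) (use lnt in \<open>force intro!: continuous_intros\<close>)+
  ultimately have "continuous_on {T..} (\<lambda>t. g t * f (ln t))"
    by (intro continuous_intros)
  then have "continuous_on {T..} (varpi_formula \<alpha> (Suc k) \<epsilon>)"
    by (subst continuous_on_cong[OF refl eq]) auto
  moreover have "strict_mono_on {T..} (varpi_formula \<alpha> (Suc k) \<epsilon>)"
  proof (rule strict_mono_onI)
    fix x y assume xy: "x \<in> {T..}" "y \<in> {T..}" "x < y"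
    have "g x < g y" using gmono xy by (auto simp: strict_mono_on_def)
    moreover have "ln x < ln y" using xy lnt(3)[of x] by auto
    then have "f (ln x) < f (ln y)"
      using fmono xy lnt(1)[of x] lnt(1)[of y] by (auto simp: strict_mono_on_def)
    ultimately have "g x * f (ln x) < g y * f (ln y)"
      using gpos[of x] fpos[OF lnt(1)[of x]] xy by (intro mult_strict_mono) auto
    then show "varpi_formula \<alpha> (Suc k) \<epsilon> x < varpi_formula \<alpha> (Suc k) \<epsilon> y"
      using eq xy by auto
  qed
  moreover have "\<forall>t\<ge>T. varpi_formula \<alpha> (Suc k) \<epsilon> t > 0"
    using eq gpos fpos lnt by auto
  moreover have "\<forall>j\<le>Suc k. ilog j T > 0"
  proof (intro allI impI)
    fix j assume j: "j \<le> Suc k"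
    have mono: "ilog i s \<ge> ilog i S" if "s \<ge> S" "i \<le> k" for s i
      using that(2)
    proof (induction i)
      case 0 then show ?case using that by simp
    next
      case (Suc i)
      have "ilog i S > 0" using S Suc.prems by (auto simp: admissible_threshold_def)
      with Suc show ?case by (simp add: ilog_def)
    qed
    show "ilog j T > 0"
    proof (cases j)
      case 0 then show ?thesis using T1 by simp
    next
      case (Suc i)
      have "ilog i S > 0" using S Suc j by (auto simp: admissible_threshold_def)
      then show ?thesis using mono[of "ln T" i] lnT Suc j by (simp add: ilog_Suc)
    qed
  qed
  ultimately show ?case unfolding admissible_threshold_def by blast
qed


section \<open>Measure-preserving actions\<close>

definition standard_borel :: "'a measure \<Rightarrow> bool" where
  "standard_borel M \<longleftrightarrow>
     (\<exists>X. topspace X = space M \<and> completely_metrizable_space X \<and> second_countable X \<and>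
          sets M = sigma_sets (space M) {U. openin X U})"

definition standard_measure_space :: "'a measure \<Rightarrow> bool" where
  "standard_measure_space M \<longleftrightarrow>
     standard_borel M \<and> sigma_finite_measure M \<and> emeasure M (space M) \<noteq> 0"

definition mp_action :: "('g, 'c) monoid_scheme \<Rightarrow> 'a measure \<Rightarrow> ('g \<Rightarrow> 'a \<Rightarrow> 'a) \<Rightarrow> bool" where
  "mp_action G M \<phi> \<longleftrightarrow>
     countable (carrier G) \<and> group_action G (space M) \<phi> \<and>
     (\<forall>g\<in>carrier G. \<phi> g \<in> measurable M M \<and> distr M M (\<phi> g) = M)"

definition ess_free :: "('g, 'c) monoid_scheme \<Rightarrow> 'a measure \<Rightarrow> ('g \<Rightarrow> 'a \<Rightarrow> 'a) \<Rightarrow> bool" where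
  "ess_free G M \<phi> \<longleftrightarrow> (AE x in M. \<forall>g\<in>carrier G. g \<noteq> \<one>\<^bsub>G\<^esub> \<longrightarrow> \<phi> g x \<noteq> x)"

definition free_pmp_action :: "('g, 'c) monoid_scheme \<Rightarrow> 'a measure \<Rightarrow> ('g \<Rightarrow> 'a \<Rightarrow> 'a) \<Rightarrow> bool" where
  "free_pmp_action G M \<phi> \<longleftrightarrow>
     standard_borel M \<and> prob_space M \<and> mp_action G M \<phi> \<and> ess_free G M \<phi>"


section \<open>Orbit equivalence\<close>

text \<open>A measure isomorphism is an almost everywhere defined bijection; it is represented by a
  total map \<open>\<Phi>\<close> together with a total map \<open>\<Psi>\<close> representing its inverse.\<close>

definition measure_iso_pair ::
    "'a measure \<Rightarrow> 'b measure \<Rightarrow> ('a \<Rightarrow> 'b) \<Rightarrow> ('b \<Rightarrow> 'a) \<Rightarrow> bool" where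
  "measure_iso_pair M N \<Phi> \<Psi> \<longleftrightarrow>
     \<Phi> \<in> measurable M N \<and> \<Psi> \<in> measurable N M \<and> distr M N \<Phi> = N \<and> distr N M \<Psi> = M \<and>
     (AE x in M. \<Psi> (\<Phi> x) = x) \<and> (AE y in N. \<Phi> (\<Psi> y) = y)"

definition orbit_equivalence ::
    "('g, 'c) monoid_scheme \<Rightarrow> 'a measure \<Rightarrow> ('g \<Rightarrow> 'a \<Rightarrow> 'a) \<Rightarrow>
     ('h, 'd) monoid_scheme \<Rightarrow> 'b measure \<Rightarrow> ('h \<Rightarrow> 'b \<Rightarrow> 'b) \<Rightarrow> ('a \<Rightarrow> 'b) \<Rightarrow> ('b \<Rightarrow> 'a) \<Rightarrow> bool" where
  "orbit_equivalence G M \<phi> H N \<psi> \<Phi> \<Psi> \<longleftrightarrow>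
     measure_iso_pair M N \<Phi> \<Psi> \<and> (AE x in M. \<Phi> ` orbit G \<phi> x = orbit H \<psi> (\<Phi> x))"

text \<open>The description below is unique for almost every \<open>x\<close>; the value on the exceptional null set
  is irrelevant, also for the integrals below.\<close>

definition oe_cocycle ::
    "('g \<Rightarrow> 'a \<Rightarrow> 'a) \<Rightarrow> ('h, 'd) monoid_scheme \<Rightarrow> ('h \<Rightarrow> 'b \<Rightarrow> 'b) \<Rightarrow> ('a \<Rightarrow> 'b) \<Rightarrow> 'g \<Rightarrow> 'a \<Rightarrow> 'h" where
  "oe_cocycle \<phi> H \<psi> \<Phi> g x = (THE h. h \<in> carrier H \<and> \<Phi> (\<phi> g x) = \<psi> h (\<Phi> x))"

text \<open>In all integrability notions, \<open>len\<close> is a word length on the target group.\<close>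

definition oe_integrable ::
    "(real \<Rightarrow> real) \<Rightarrow> ('g, 'c) monoid_scheme \<Rightarrow> 'a measure \<Rightarrow> ('g \<Rightarrow> 'a \<Rightarrow> 'a) \<Rightarrow>
     ('h, 'd) monoid_scheme \<Rightarrow> ('h \<Rightarrow> real) \<Rightarrow> ('h \<Rightarrow> 'b \<Rightarrow> 'b) \<Rightarrow> ('a \<Rightarrow> 'b) \<Rightarrow> bool" where
  "oe_integrable \<omega> G M \<phi> H len \<psi> \<Phi> \<longleftrightarrow>
     (\<forall>g\<in>carrier G. \<exists>c>0.
        (\<integral>\<^sup>+x. ennreal (\<omega> (len (oe_cocycle \<phi> H \<psi> \<Phi> g x) / c)) \<partial>M) < \<infinity>)"

text \<open>The existential quantifiers range over spaces with points in \<open>real\<close>. This is no restriction: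
  every standard Borel space is isomorphic to one whose underlying set consists of reals.\<close>

definition integrably_orbit_equivalent ::
    "(real \<Rightarrow> real) \<Rightarrow> (real \<Rightarrow> real) \<Rightarrow> ('g, 'c) monoid_scheme \<Rightarrow> ('g \<Rightarrow> real) \<Rightarrow>
     ('h, 'd) monoid_scheme \<Rightarrow> ('h \<Rightarrow> real) \<Rightarrow> bool" where
  "integrably_orbit_equivalent \<omega>\<^sub>1 \<omega>\<^sub>2 G len\<^sub>G H len\<^sub>H \<longleftrightarrow>
     (\<exists>(M :: real measure) \<phi> (N :: real measure) \<psi> \<Phi> \<Psi>.
        free_pmp_action G M \<phi> \<and> free_pmp_action H N \<psi> \<and>
        orbit_equivalence G M \<phi> H N \<psi> \<Phi> \<Psi> \<and>
        oe_integrable \<omega>\<^sub>1 G M \<phi> H len\<^sub>H \<psi> \<Phi> \<and>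
        oe_integrable \<omega>\<^sub>2 H N \<psi> G len\<^sub>G \<phi> \<Psi>)"


section \<open>Measure equivalence\<close>

definition fundamental_domain ::
    "('g, 'c) monoid_scheme \<Rightarrow> 'a measure \<Rightarrow> ('g \<Rightarrow> 'a \<Rightarrow> 'a) \<Rightarrow> 'a set \<Rightarrow> bool" where
  "fundamental_domain G M \<phi> D \<longleftrightarrow> D \<in> sets M \<and> (AE x in M. card (D \<inter> orbit G \<phi> x) = 1)"

definition me_coupling ::
    "('g, 'c) monoid_scheme \<Rightarrow> ('h, 'd) monoid_scheme \<Rightarrow>
     'a measure \<Rightarrow> ('g \<Rightarrow> 'a \<Rightarrow> 'a) \<Rightarrow> ('h \<Rightarrow> 'a \<Rightarrow> 'a) \<Rightarrow> 'a set \<Rightarrow> 'a set \<Rightarrow> bool" where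
  "me_coupling G H M \<phi> \<psi> D\<^sub>G D\<^sub>H \<longleftrightarrow>
     standard_measure_space M \<and>
     mp_action G M \<phi> \<and> ess_free G M \<phi> \<and> mp_action H M \<psi> \<and> ess_free H M \<psi> \<and>
     (AE x in M. \<forall>g\<in>carrier G. \<forall>h\<in>carrier H. \<phi> g (\<psi> h x) = \<psi> h (\<phi> g x)) \<and>
     fundamental_domain G M \<phi> D\<^sub>G \<and> fundamental_domain H M \<psi> D\<^sub>H \<and>
     emeasure M D\<^sub>G < \<infinity> \<and> emeasure M D\<^sub>H < \<infinity>"

definition induced_action ::
    "('g \<Rightarrow> 'a \<Rightarrow> 'a) \<Rightarrow> ('h, 'd) monoid_scheme \<Rightarrow> ('h \<Rightarrow> 'a \<Rightarrow> 'a) \<Rightarrow> 'a set \<Rightarrow> 'g \<Rightarrow> 'a \<Rightarrow> 'a" where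
  "induced_action \<phi> H \<psi> D\<^sub>H g x = (THE y. y \<in> D\<^sub>H \<inter> orbit H \<psi> (\<phi> g x))"

definition me_cocycle ::
    "('g \<Rightarrow> 'a \<Rightarrow> 'a) \<Rightarrow> ('h, 'd) monoid_scheme \<Rightarrow> ('h \<Rightarrow> 'a \<Rightarrow> 'a) \<Rightarrow> 'a set \<Rightarrow> 'g \<Rightarrow> 'a \<Rightarrow> 'h" where
  "me_cocycle \<phi> H \<psi> D\<^sub>H g x =
     (THE h. h \<in> carrier H \<and> \<psi> h (\<phi> g x) = induced_action \<phi> H \<psi> D\<^sub>H g x)"

definition me_integrable ::
    "(real \<Rightarrow> real) \<Rightarrow> ('g, 'c) monoid_scheme \<Rightarrow> ('h, 'd) monoid_scheme \<Rightarrow> ('h \<Rightarrow> real) \<Rightarrow>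
     'a measure \<Rightarrow> ('g \<Rightarrow> 'a \<Rightarrow> 'a) \<Rightarrow> ('h \<Rightarrow> 'a \<Rightarrow> 'a) \<Rightarrow> 'a set \<Rightarrow> bool" where
  "me_integrable \<omega> G H len M \<phi> \<psi> D\<^sub>H \<longleftrightarrow>
     (\<forall>g\<in>carrier G. \<exists>c>0.
        (\<integral>\<^sup>+x\<in>D\<^sub>H. ennreal (\<omega> (len (me_cocycle \<phi> H \<psi> D\<^sub>H g x) / c)) \<partial>M) < \<infinity>)"

definition integrably_measure_equivalent ::
    "(real \<Rightarrow> real) \<Rightarrow> (real \<Rightarrow> real) \<Rightarrow> ('g, 'c) monoid_scheme \<Rightarrow> ('g \<Rightarrow> real) \<Rightarrow>
     ('h, 'd) monoid_scheme \<Rightarrow> ('h \<Rightarrow> real) \<Rightarrow> bool" where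
  "integrably_measure_equivalent \<omega>\<^sub>1 \<omega>\<^sub>2 G len\<^sub>G H len\<^sub>H \<longleftrightarrow>
     (\<exists>(M :: real measure) \<phi> \<psi> D\<^sub>G D\<^sub>H.
        me_coupling G H M \<phi> \<psi> D\<^sub>G D\<^sub>H \<and>
        me_integrable \<omega>\<^sub>1 G H len\<^sub>H M \<phi> \<psi> D\<^sub>H \<and>
        me_integrable \<omega>\<^sub>2 H G len\<^sub>G M \<psi> \<phi> D\<^sub>G)"


section \<open>The groups $\mathbb{Z}^d$\<close>

definition Zpow :: "nat \<Rightarrow> (nat \<Rightarrow> int) monoid" where
  "Zpow d = product_group {..<d} (\<lambda>_. integer_group)"

definition Zpow_length :: "nat \<Rightarrow> (nat \<Rightarrow> int) \<Rightarrow> real" where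
  "Zpow_length d v = (\<Sum>i<d. \<bar>real_of_int (v i)\<bar>)"

end

theory Submission
  imports Defs
begin

text \<open>
  All groups \<open>\<int>\<^sup>d\<close> act on one and the same space, the sequences \<open>x\<close> of independent fair bits. For the
  rank \<open>d\<close>, cut \<open>x\<close> into \<open>d\<close> interleaved subsequences, read each of them as a 2-adic integer, and let
  \<open>\<int>\<^sup>d\<close> act by translations. These odometer actions are free and preserve the measure. Adding
  \<open>v\<close> changes a bit of \<open>x\<close> at a position beyond \<open>d * J\<close> only if the addition carries past the \<open>J\<close>-th digit
  of some coordinate, which has probability at most \<open>\<bar>v\<bar> / 2 ^ J\<close>. Hence almost surely only finitely
  many bits change. Conversely, two sequences that agree from position \<open>d * J\<close> on differ by a
  translation in \<open>\<int>\<^sup>d\<close> of length at most \<open>d * 2 ^ J\<close>. So almost everywhere the orbits are the classes of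
  eventual equality, for every rank, and the identity is an orbit equivalence from \<open>\<int>\<^sup>n\<close> to \<open>\<int>\<^sup>m\<close>.

  The same two facts estimate the cocycle. Unless adding \<open>v \<in> \<int>\<^sup>n\<close> carries past the \<open>J\<close>-th digits, the
  change is confined to positions below \<open>n * J\<close>, that is, to about \<open>n * J / m\<close> digits in each of \<open>m\<close>
  coordinates, and its cocycle has length at most of order \<open>2 powr (n * J / m)\<close>. The integral of \<open>\<omega>\<close> of the
  length is therefore dominated by the series \<open>\<Sum>J. \<omega> (2 powr (n * J / m)) / 2 ^ J\<close>. For
  \<open>\<omega> = varpi T (m / n) k \<epsilon>\<close> the power of \<open>t\<close> cancels \<open>2 ^ J\<close>, and the general term is eventually
  \<open>1 / (Lambda k t * ilog k t powr \<epsilon>)\<close> at \<open>t = 2 powr (n * J / m)\<close>. Since \<open>ln t\<close> is proportional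
  to \<open>J\<close>, this is comparable with \<open>1 / (J * ln J * ln (ln J) * \<dots>)\<close>, the last iterated logarithm having the
  exponent \<open>1 + \<epsilon>\<close>: a convergent series, by comparison with an antiderivative. The exchange of \<open>n\<close> and \<open>m\<close>
  gives the integrability of the inverse.

  Measure equivalence follows from a general fact: an orbit equivalence \<open>\<Phi>\<close> gives a measure on pairs
  \<open>(x, y)\<close> with \<open>y\<close> in the orbit of \<open>\<Phi> x\<close>, on which the two groups act on separate coordinates, with the graph
  of \<open>\<Phi>\<close> as a common fundamental domain and with the cocycles of \<open>\<Phi>\<close> and of its inverse.

  The main steps are \<open>odometer_no_carry\<close>, \<open>tail_equal_imp_translate\<close>, \<open>carry_event_bound\<close>,
  \<open>summable_varpi_powers\<close> and \<open>integrably_orbit_equivalent_imp_measure_equivalent\<close>.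
\<close>


section \<open>Actions and their transport along injections\<close>

text \<open>A family of maps that multiplies like the group consists of bijections, because the
  inverse element provides the inverse map; so only the algebraic laws have to be checked.\<close>

lemma group_actionI:
  fixes G (structure)
  assumes G: "group G"
    and closed: "\<And>g x. g \<in> carrier G \<Longrightarrow> x \<in> E \<Longrightarrow> \<phi> g x \<in> E"
    and ext: "\<And>g. g \<in> carrier G \<Longrightarrow> \<phi> g \<in> extensional E"
    and one: "\<And>x. x \<in> E \<Longrightarrow> \<phi> \<one> x = x"
    and mult: "\<And>g h x. g \<in> carrier G \<Longrightarrow> h \<in> carrier G \<Longrightarrow> x \<in> E \<Longrightarrow>
      \<phi> (g \<otimes> h) x = \<phi> g (\<phi> h x)"
  shows "group_action G E \<phi>"
proof -
  interpret group G by fact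
  have bij: "\<phi> g \<in> Bij E" if g: "g \<in> carrier G" for g
  proof -
    have "\<phi> (inv g) (\<phi> g x) = x" "\<phi> g (\<phi> (inv g) x) = x" if "x \<in> E" for x
      using mult[of "inv g" g x] mult[of g "inv g" x] g that by (simp_all add: one)
    then have "bij_betw (\<phi> g) E E"
      using g closed by (intro bij_betw_byWitness[where f' = "\<phi> (inv g)"]) auto
    then show ?thesis using ext[OF g] by (simp add: Bij_def)
  qed
  have "\<phi> \<in> hom G (BijGroup E)"
  proof (rule homI)
    fix g h assume gh: "g \<in> carrier G" "h \<in> carrier G"
    have "\<phi> (g \<otimes> h) = compose E (\<phi> g) (\<phi> h)"
      using gh ext[of "g \<otimes> h"] mult[OF gh]
      by (intro extensionalityI[where A = E]) (auto simp: compose_eq compose_extensional)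
    then show "\<phi> (g \<otimes> h) = \<phi> g \<otimes>\<^bsub>BijGroup E\<^esub> \<phi> h"
      using bij gh by (simp add: BijGroup_def)
  qed (use bij in \<open>simp add: BijGroup_def\<close>)
  then show ?thesis
    using G group_BijGroup by (simp add: group_action_def group_hom_def group_hom_axioms_def)
qed

text \<open>For an integrand that is not known to be measurable, only this half of the change of variables
  formula survives: a simple function below \<open>f\<close> pulls back to a measurable function below
  \<open>f \<circ> T\<close>. It suffices for proving integrals finite, and so the cocycles, which are
  given by definite descriptions, need no measurability proof.\<close>

lemma nn_integral_distr_le:
  assumes T: "T \<in> measurable M N"
  shows "(\<integral>\<^sup>+y. f y \<partial>distr M N T) \<le> (\<integral>\<^sup>+x. f (T x) \<partial>M)"
  unfolding nn_integral_def[of "distr M N T"]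
proof (rule SUP_least)
  fix g assume "g \<in> {g. simple_function (distr M N T) g \<and> g \<le> f}"
  then have g: "simple_function (distr M N T) g" "g \<le> f" by auto
  have "g \<in> borel_measurable N" using borel_measurable_simple_function[OF g(1)] by simp
  then have "integral\<^sup>S (distr M N T) g = (\<integral>\<^sup>+x. g (T x) \<partial>M)"
    using nn_integral_eq_simple_integral[OF g(1)] nn_integral_distr[OF T] by simp
  also have "\<dots> \<le> (\<integral>\<^sup>+x. f (T x) \<partial>M)"
    using g(2) by (intro nn_integral_mono) (auto simp: le_fun_def)
  finally show "integral\<^sup>S (distr M N T) g \<le> (\<integral>\<^sup>+x. f (T x) \<partial>M)" .
qed

text \<open>The action that \<open>e\<close> carries from \<open>M\<close> to \<open>embed_measure M e\<close>. The group actions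
  considered here consist of extensional maps, whence the restriction to the image of the space.\<close>

definition relabel :: "('a \<Rightarrow> 'b) \<Rightarrow> 'a measure \<Rightarrow> ('g \<Rightarrow> 'a \<Rightarrow> 'a) \<Rightarrow> 'g \<Rightarrow> 'b \<Rightarrow> 'b" where
  "relabel e M \<phi> g = (\<lambda>y\<in>e ` space M. e (\<phi> g (the_inv e y)))"

lemma relabel_apply: "inj e \<Longrightarrow> x \<in> space M \<Longrightarrow> relabel e M \<phi> g (e x) = e (\<phi> g x)"
  by (simp add: relabel_def the_inv_f_f)

lemma mp_action_closed:
  assumes "mp_action G M \<phi>" "g \<in> carrier G" "x \<in> space M"
  shows "\<phi> g x \<in> space M"
proof -
  have "\<phi> g \<in> measurable M M" using assms by (simp add: mp_action_def)
  then show ?thesis using assms(3) by (rule measurable_space)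
qed

lemma orbit_relabel:
  assumes "inj e" "x \<in> space M"
  shows "orbit G (relabel e M \<phi>) (e x) = e ` orbit G \<phi> x"
  using assms by (auto simp: orbit_def relabel_apply)

lemma nn_integral_embed_measure_le:
  assumes "inj e"
  shows "(\<integral>\<^sup>+y. f y \<partial>embed_measure M e) \<le> (\<integral>\<^sup>+x. f (e x) \<partial>M)"
  by (subst embed_measure_eq_distr[OF assms])
    (rule nn_integral_distr_le[OF measurable_embed_measure2[OF assms]])

lemma mp_action_relabel:
  assumes e: "inj e" and act: "mp_action G M \<phi>"
  shows "mp_action G (embed_measure M e) (relabel e M \<phi>)"
  unfolding mp_action_def
proof (intro conjI ballI)
  interpret group_action G "space M" \<phi> using act by (simp add: mp_action_def)
  show "countable (carrier G)" using act by (simp add: mp_action_def)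
  show "group_action G (space (embed_measure M e)) (relabel e M \<phi>)"
    unfolding space_embed_measure
  proof (rule group_actionI)
    show "group G" using group_hom group_hom.axioms(1) by auto
    show "relabel e M \<phi> \<one>\<^bsub>G\<^esub> y = y" if "y \<in> e ` space M" for y
      using that e by (auto simp: relabel_apply simp flip: id_eq_one)
    show "relabel e M \<phi> g \<in> extensional (e ` space M)" for g by (simp add: relabel_def)
    show "relabel e M \<phi> g y \<in> e ` space M" if "g \<in> carrier G" "y \<in> e ` space M" for g y
      using that by (auto simp: relabel_apply e mp_action_closed[OF act])
    show "relabel e M \<phi> (g \<otimes>\<^bsub>G\<^esub> h) y = relabel e M \<phi> g (relabel e M \<phi> h y)"
      if "g \<in> carrier G" "h \<in> carrier G" "y \<in> e ` space M" for g h y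
      using that by (auto simp: relabel_apply e mp_action_closed[OF act] composition_rule)
  qed
  fix g assume g: "g \<in> carrier G"
  let ?M = "embed_measure M e"
  have [measurable]: "\<phi> g \<in> measurable M M" and dist: "distr M M (\<phi> g) = M"
    using act g by (auto simp: mp_action_def)
  note [measurable] = measurable_embed_measure2[OF e, of M]
  have "(\<lambda>x. e (\<phi> g x)) \<in> measurable M ?M" by measurable
  then have "(\<lambda>x. relabel e M \<phi> g (e x)) \<in> measurable M ?M"
    by (rule measurable_cong[THEN iffD2, rotated]) (simp add: relabel_apply e)
  then show [measurable]: "relabel e M \<phi> g \<in> measurable ?M ?M"
    by (rule measurable_embed_measure1)
  have "distr ?M ?M (relabel e M \<phi> g) = distr (distr M ?M e) ?M (relabel e M \<phi> g)"
    using embed_measure_eq_distr[OF e] by metis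
  also have "\<dots> = distr M ?M (\<lambda>x. e (\<phi> g x))"
    by (subst distr_distr) (auto intro!: distr_cong simp: relabel_apply e)
  also have "\<dots> = distr (distr M M (\<phi> g)) ?M e"
    by (subst distr_distr) (auto simp: comp_def)
  also have "\<dots> = ?M" unfolding dist by (rule embed_measure_eq_distr[OF e, symmetric])
  finally show "distr ?M ?M (relabel e M \<phi> g) = ?M" .
qed

lemma ess_free_relabel:
  assumes e: "inj e" and "ess_free G M \<phi>"
  shows "ess_free G (embed_measure M e) (relabel e M \<phi>)"
  using assms(2) AE_space[of M] unfolding ess_free_def AE_embed_measure[OF e]
  by eventually_elim (simp add: relabel_apply e inj_eq[OF e])

text \<open>The topology is transported along with the points: the open sets of the new space are the images
  of the old ones, so that \<open>e\<close> becomes a homeomorphism.\<close>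

lemma standard_borel_embed_measure:
  assumes e: "inj e" and "standard_borel M"
  shows "standard_borel (embed_measure M e)"
proof -
  obtain X where X: "topspace X = space M" "completely_metrizable_space X" "second_countable X"
      "sets M = sigma_sets (space M) {U. openin X U}"
    using assms(2) by (auto simp: standard_borel_def)
  have inj: "inj_on e (space M)" using e by (rule inj_on_subset) simp
  define Y where "Y = pullback_topology (e ` space M) (the_inv e) X"
  have opens: "openin Y U \<longleftrightarrow> (\<exists>V. openin X V \<and> U = e ` V)" for U
  proof -
    have "the_inv e -` V \<inter> e ` space M = e ` V" if "openin X V" for V
      using openin_subset[OF that] X(1) e by (auto simp: the_inv_f_f)
    then show ?thesis unfolding Y_def openin_pullback_topology by metis
  qed
  have top: "topspace Y = e ` space M"
    using X(1) e by (auto simp: Y_def topspace_pullback_topology the_inv_f_f)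
  have pre: "{x \<in> space M. e x \<in> e ` V} = V" if "openin X V" for V
    using openin_subset[OF that] X(1) e by (auto simp: inj_eq[OF e])
  have "openin X {x \<in> space M. e x \<in> U} \<longleftrightarrow> openin Y U" if "U \<subseteq> e ` space M" for U
  proof
    assume "openin X {x \<in> space M. e x \<in> U}"
    moreover have "U = e ` {x \<in> space M. e x \<in> U}" using that by blast
    ultimately show "openin Y U" unfolding opens by blast
  qed (auto simp: opens pre)
  then have "homeomorphic_map X Y e"
    using inj by (simp add: homeomorphic_map_def quotient_map_def X(1) top)
  then have hom: "X homeomorphic_space Y" by (rule homeomorphic_map_imp_homeomorphic_space)
  let ?d = "the_inv_into (space M) e"
  have vimage: "{?d -` A \<inter> e ` space M | A. A \<in> \<A>} = (`) e ` \<A>" if "\<And>A. A \<in> \<A> \<Longrightarrow> A \<subseteq> space M" for \<A>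
  proof -
    have "{?d -` A \<inter> e ` space M | A. A \<in> \<A>} = (\<lambda>A. ?d -` A \<inter> e ` space M) ` \<A>" by blast
    also have "\<dots> = (`) e ` \<A>"
      by (rule image_cong[OF refl]) (rule the_inv_into_vimage[OF inj that])
    finally show ?thesis .
  qed
  have "sets (embed_measure M e) = (`) e ` sets M"
    unfolding sets_embed_measure[OF e] by blast
  also have "\<dots> = {?d -` A \<inter> e ` space M | A. A \<in> sets M}"
    by (rule vimage[symmetric]) (rule sets.sets_into_space)
  also have "\<dots> = sigma_sets (e ` space M) {?d -` A \<inter> e ` space M | A. A \<in> {U. openin X U}}"
    unfolding X(4) by (rule sigma_sets_vimage_commute) (auto simp: the_inv_into_f_f inj)
  also have "{?d -` A \<inter> e ` space M | A. A \<in> {U. openin X U}} = (`) e ` {U. openin X U}"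
    by (rule vimage) (use openin_subset X(1) in auto)
  also have "\<dots> = {U. openin Y U}" unfolding opens by blast
  finally have "sets (embed_measure M e) = sigma_sets (space (embed_measure M e)) {U. openin Y U}"
    by (simp add: space_embed_measure)
  then show ?thesis
    unfolding standard_borel_def
    using top X(2,3) homeomorphic_completely_metrizable_space[OF hom]
      homeomorphic_space_second_countability[OF hom]
    by (intro exI[of _ Y]) (simp add: space_embed_measure)
qed

lemma prob_space_embed_measure:
  assumes "inj e" "prob_space M"
  shows "prob_space (embed_measure M e)"
  by (subst embed_measure_eq_distr[OF assms(1)])
    (rule prob_space.prob_space_distr[OF assms(2) measurable_embed_measure2[OF assms(1)]])

lemma free_pmp_action_relabel:
  assumes "inj e" "free_pmp_action G M \<phi>"
  shows "free_pmp_action G (embed_measure M e) (relabel e M \<phi>)"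
  using assms
  by (simp add: free_pmp_action_def mp_action_relabel ess_free_relabel standard_borel_embed_measure
      prob_space_embed_measure)

lemma oe_integrable_relabel:
  assumes e: "inj e" and "mp_action G M \<phi>" "mp_action H M \<psi>"
    and int: "oe_integrable \<omega> G M \<phi> H len \<psi> (\<lambda>x. x)"
  shows "oe_integrable \<omega> G (embed_measure M e) (relabel e M \<phi>) H len (relabel e M \<psi>) (\<lambda>x. x)"
  unfolding oe_integrable_def
proof
  fix g assume g: "g \<in> carrier G"
  obtain c where c: "c > 0"
    "(\<integral>\<^sup>+x. ennreal (\<omega> (len (oe_cocycle \<phi> H \<psi> (\<lambda>x. x) g x) / c)) \<partial>M) < \<infinity>"
    using int g by (auto simp: oe_integrable_def)
  have "oe_cocycle (relabel e M \<phi>) H (relabel e M \<psi>) (\<lambda>x. x) g (e x) = oe_cocycle \<phi> H \<psi> (\<lambda>x. x) g x"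
    if "x \<in> space M" for x
    using that e by (simp add: oe_cocycle_def relabel_apply inj_eq[OF e])
  then have "(\<integral>\<^sup>+y. ennreal (\<omega> (len (oe_cocycle (relabel e M \<phi>) H (relabel e M \<psi>) (\<lambda>x. x) g y) / c))
      \<partial>embed_measure M e) \<le> (\<integral>\<^sup>+x. ennreal (\<omega> (len (oe_cocycle \<phi> H \<psi> (\<lambda>x. x) g x) / c)) \<partial>M)"
    by (intro order_trans[OF nn_integral_embed_measure_le[OF e]] nn_integral_mono) simp
  then show "\<exists>c>0. (\<integral>\<^sup>+y. ennreal (\<omega> (len (oe_cocycle (relabel e M \<phi>) H (relabel e M \<psi>) (\<lambda>x. x) g y) / c))
      \<partial>embed_measure M e) < \<infinity>"
    using c by (auto intro: le_less_trans)
qed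

text \<open>The identity is the orbit equivalence, and the injection supplies the real points that the
  definition asks for.\<close>

lemma integrably_orbit_equivalentI:
  fixes e :: "'a \<Rightarrow> real" and M :: "'a measure"
  assumes e: "inj e"
    and free: "free_pmp_action G M \<phi>" "free_pmp_action H M \<psi>"
    and orb: "AE x in M. orbit G \<phi> x = orbit H \<psi> x"
    and int: "oe_integrable \<omega>\<^sub>1 G M \<phi> H len\<^sub>H \<psi> (\<lambda>x. x)" "oe_integrable \<omega>\<^sub>2 H M \<psi> G len\<^sub>G \<phi> (\<lambda>x. x)"
  shows "integrably_orbit_equivalent \<omega>\<^sub>1 \<omega>\<^sub>2 G len\<^sub>G H len\<^sub>H"
proof -
  let ?M = "embed_measure M e"
  have mp: "mp_action G M \<phi>" "mp_action H M \<psi>" using free by (auto simp: free_pmp_action_def)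
  have "AE y in ?M. orbit G (relabel e M \<phi>) y = orbit H (relabel e M \<psi>) y"
    using orb AE_space[of M] unfolding AE_embed_measure[OF e]
    by eventually_elim (simp add: orbit_relabel e)
  then have "orbit_equivalence G ?M (relabel e M \<phi>) H ?M (relabel e M \<psi>) (\<lambda>x. x) (\<lambda>x. x)"
    by (simp add: orbit_equivalence_def measure_iso_pair_def distr_id[unfolded id_def])
  with free_pmp_action_relabel[OF e free(1)] free_pmp_action_relabel[OF e free(2)]
    oe_integrable_relabel[OF e mp int(1)] oe_integrable_relabel[OF e mp(2,1) int(2)]
  have "free_pmp_action G ?M (relabel e M \<phi>) \<and> free_pmp_action H ?M (relabel e M \<psi>) \<and>
      orbit_equivalence G ?M (relabel e M \<phi>) H ?M (relabel e M \<psi>) (\<lambda>x. x) (\<lambda>x. x) \<and>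
      oe_integrable \<omega>\<^sub>1 G ?M (relabel e M \<phi>) H len\<^sub>H (relabel e M \<psi>) (\<lambda>x. x) \<and>
      oe_integrable \<omega>\<^sub>2 H ?M (relabel e M \<psi>) G len\<^sub>G (relabel e M \<phi>) (\<lambda>x. x)"
    by simp
  then show ?thesis unfolding integrably_orbit_equivalent_def by (intro exI)
qed

lemma fundamental_domain_relabel:
  assumes e: "inj e" and "fundamental_domain G M \<phi> A"
  shows "fundamental_domain G (embed_measure M e) (relabel e M \<phi>) (e ` A)"
proof -
  have "AE x in M. card (e ` A \<inter> orbit G (relabel e M \<phi>) (e x)) = 1"
    using assms(2) AE_space[of M] unfolding fundamental_domain_def
    by (auto elim!: eventually_elim2 simp: orbit_relabel[OF e] card_image inj_on_subset[OF e]
        simp flip: image_Int[OF e])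
  then show ?thesis
    using assms by (simp add: fundamental_domain_def in_sets_embed_measure AE_embed_measure)
qed

text \<open>The fundamental domain meets almost every orbit in a single point, and then the definite
  descriptions in the cocycle commute with the relabelling.\<close>

lemma me_integrable_relabel:
  assumes e: "inj e" and G: "mp_action G M \<phi>" and H: "mp_action H M \<psi>"
    and fd: "fundamental_domain H M \<psi> B" and int: "me_integrable \<omega> G H len M \<phi> \<psi> B"
  shows "me_integrable \<omega> G H len (embed_measure M e) (relabel e M \<phi>) (relabel e M \<psi>) (e ` B)"
  unfolding me_integrable_def
proof
  fix g assume g: "g \<in> carrier G"
  let ?\<phi> = "relabel e M \<phi>" and ?\<psi> = "relabel e M \<psi>"
  obtain c where c: "c > 0"
    "(\<integral>\<^sup>+x\<in>B. ennreal (\<omega> (len (me_cocycle \<phi> H \<psi> B g x) / c)) \<partial>M) < \<infinity>"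
    using int g by (auto simp: me_integrable_def)
  have gm: "\<phi> g \<in> measurable M M" "distr M M (\<phi> g) = M"
    using G g by (auto simp: mp_action_def)
  have "AE x in M. card (B \<inter> orbit H \<psi> (\<phi> g x)) = 1"
    by (rule AE_distrD[OF gm(1)]) (unfold gm(2), use fd in \<open>simp add: fundamental_domain_def\<close>)
  then have "AE x in M. me_cocycle ?\<phi> H ?\<psi> (e ` B) g (e x) = me_cocycle \<phi> H \<psi> B g x"
    using AE_space[of M]
  proof eventually_elim
    case (elim x)
    have gx: "\<phi> g x \<in> space M" by (rule mp_action_closed[OF G g elim(2)])
    obtain b where b: "B \<inter> orbit H \<psi> (\<phi> g x) = {b}" using elim(1) card_1_singletonE by blast
    then have "e ` B \<inter> orbit H ?\<psi> (e (\<phi> g x)) = {e b}"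
      by (simp add: orbit_relabel[OF e gx] flip: image_Int[OF e])
    then have "induced_action ?\<phi> H ?\<psi> (e ` B) g (e x) = e b"
      by (simp add: induced_action_def relabel_apply[OF e elim(2)])
    moreover have "induced_action \<phi> H \<psi> B g x = b"
      using b by (simp add: induced_action_def)
    ultimately show ?case
      by (simp add: me_cocycle_def relabel_apply[OF e elim(2)] relabel_apply[OF e gx] inj_eq[OF e])
  qed
  then have eq: "(\<integral>\<^sup>+x. ennreal (\<omega> (len (me_cocycle ?\<phi> H ?\<psi> (e ` B) g (e x)) / c)) * indicator (e ` B) (e x) \<partial>M)
      = (\<integral>\<^sup>+x\<in>B. ennreal (\<omega> (len (me_cocycle \<phi> H \<psi> B g x) / c)) \<partial>M)"
    by (intro nn_integral_cong_AE)
      (auto elim!: eventually_mono simp: indicator_def inj_image_mem_iff[OF e])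
  have "(\<integral>\<^sup>+y\<in>e ` B. ennreal (\<omega> (len (me_cocycle ?\<phi> H ?\<psi> (e ` B) g y) / c)) \<partial>embed_measure M e) < \<infinity>"
    by (rule le_less_trans[OF nn_integral_embed_measure_le[OF e]]) (simp only: eq c(2))
  then show "\<exists>c>0. (\<integral>\<^sup>+y\<in>e ` B. ennreal (\<omega> (len (me_cocycle ?\<phi> H ?\<psi> (e ` B) g y) / c)) \<partial>embed_measure M e) < \<infinity>"
    using c(1) by blast
qed

lemma me_coupling_relabel:
  assumes e: "inj e" and cpl: "me_coupling G H M \<phi> \<psi> A B"
  shows "me_coupling G H (embed_measure M e) (relabel e M \<phi>) (relabel e M \<psi>) (e ` A) (e ` B)"
proof -
  have mp: "mp_action G M \<phi>" "mp_action H M \<psi>" using cpl by (auto simp: me_coupling_def)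
  have AB: "A \<in> sets M" "B \<in> sets M"
    using cpl by (auto simp: me_coupling_def fundamental_domain_def)
  have "AE x in M. \<forall>g\<in>carrier G. \<forall>h\<in>carrier H. \<phi> g (\<psi> h x) = \<psi> h (\<phi> g x)"
    using cpl by (simp add: me_coupling_def)
  then have comm: "AE x in M. \<forall>g\<in>carrier G. \<forall>h\<in>carrier H.
      relabel e M \<phi> g (relabel e M \<psi> h (e x)) = relabel e M \<psi> h (relabel e M \<phi> g (e x))"
    using AE_space[of M]
    by eventually_elim (simp add: relabel_apply[OF e] mp_action_closed[OF mp(1)] mp_action_closed[OF mp(2)])
  have em: "emeasure (embed_measure M e) (e ` X) = emeasure M X" if "X \<in> sets M" for X
    using that by (rule emeasure_embed_measure_image[OF e])
  have "standard_measure_space (embed_measure M e)"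
    using cpl em[OF sets.top[of M]]
    by (simp add: me_coupling_def standard_measure_space_def standard_borel_embed_measure[OF e]
        sigma_finite_embed_measure[OF _ e] space_embed_measure)
  with comm show ?thesis
    using cpl by (simp add: me_coupling_def mp_action_relabel[OF e] ess_free_relabel[OF e]
        fundamental_domain_relabel[OF e] em[OF AB(1)] em[OF AB(2)] AE_embed_measure[OF e])
qed

lemma integrably_measure_equivalentI:
  fixes e :: "'a \<Rightarrow> real" and M :: "'a measure"
  assumes e: "inj e" and cpl: "me_coupling G H M \<phi> \<psi> A B"
    and int: "me_integrable \<omega>\<^sub>1 G H len\<^sub>H M \<phi> \<psi> B" "me_integrable \<omega>\<^sub>2 H G len\<^sub>G M \<psi> \<phi> A"
  shows "integrably_measure_equivalent \<omega>\<^sub>1 \<omega>\<^sub>2 G len\<^sub>G H len\<^sub>H"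
proof -
  have "mp_action G M \<phi>" "mp_action H M \<psi>" "fundamental_domain G M \<phi> A" "fundamental_domain H M \<psi> B"
    using cpl by (auto simp: me_coupling_def)
  then have "me_integrable \<omega>\<^sub>1 G H len\<^sub>H (embed_measure M e) (relabel e M \<phi>) (relabel e M \<psi>) (e ` B) \<and>
      me_integrable \<omega>\<^sub>2 H G len\<^sub>G (embed_measure M e) (relabel e M \<psi>) (relabel e M \<phi>) (e ` A)"
    using int by (simp add: me_integrable_relabel[OF e])
  with me_coupling_relabel[OF e cpl] show ?thesis
    unfolding integrably_measure_equivalent_def by (intro exI conjI) auto
qed

section \<open>Products of standard Borel spaces\<close>

text \<open>The product topology serves. Its open sets are measurable for the product \<open>\<sigma>\<close>-algebra since,
  by second countability, each of them is a countable union of boxes; conversely both projections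
  are continuous.\<close>

lemma standard_borel_pair:
  assumes "standard_borel M" "standard_borel N"
  shows "standard_borel (M \<Otimes>\<^sub>M N)"
proof -
  obtain X where X: "topspace X = space M" "completely_metrizable_space X" "second_countable X"
      "sets M = sigma_sets (space M) {U. openin X U}"
    using assms(1) by (auto simp: standard_borel_def)
  obtain Y where Y: "topspace Y = space N" "completely_metrizable_space Y" "second_countable Y"
      "sets N = sigma_sets (space N) {U. openin Y U}"
    using assms(2) by (auto simp: standard_borel_def)
  let ?P = "prod_topology X Y"
  have openM: "U \<in> sets M" if "openin X U" for U unfolding X(4) using that by blast
  have openN: "U \<in> sets N" if "openin Y U" for U unfolding Y(4) using that by blast
  obtain B where B: "countable B" "\<And>V. V \<in> B \<Longrightarrow> openin X V"
      "\<And>U x. openin X U \<Longrightarrow> x \<in> U \<Longrightarrow> \<exists>V\<in>B. x \<in> V \<and> V \<subseteq> U"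
    using X(3) by (auto simp: second_countable_def)
  obtain C where C: "countable C" "\<And>V. V \<in> C \<Longrightarrow> openin Y V"
      "\<And>U x. openin Y U \<Longrightarrow> x \<in> U \<Longrightarrow> \<exists>V\<in>C. x \<in> V \<and> V \<subseteq> U"
    using Y(3) by (auto simp: second_countable_def)
  define D where "D = (\<lambda>(U, V). U \<times> V) ` (B \<times> C)"
  have D: "countable D" using B(1) C(1) by (simp add: D_def)
  have D_open: "openin ?P W" if "W \<in> D" for W
    using that B(2) C(2) by (auto simp: D_def openin_prod_Times_iff)
  have base: "\<exists>V\<in>D. w \<in> V \<and> V \<subseteq> W" if W: "openin ?P W" "w \<in> W" for W w
  proof -
    obtain x y where w: "w = (x, y)" by (cases w)
    obtain U V where UV: "openin X U" "openin Y V" "x \<in> U" "y \<in> V" "U \<times> V \<subseteq> W"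
      using W unfolding w openin_prod_topology_alt by metis
    obtain U' where U': "U' \<in> B" "x \<in> U'" "U' \<subseteq> U" using B(3)[OF UV(1,3)] by blast
    obtain V' where V': "V' \<in> C" "y \<in> V'" "V' \<subseteq> V" using C(3)[OF UV(2,4)] by blast
    show ?thesis
    proof (intro bexI conjI)
      show "U' \<times> V' \<in> D" using U'(1) V'(1) by (auto simp: D_def)
      show "w \<in> U' \<times> V'" using U' V' w by simp
      show "U' \<times> V' \<subseteq> W" using U'(3) V'(3) UV(5) by blast
    qed
  qed
  have sc: "second_countable ?P"
    unfolding second_countable_def
  proof (intro exI[of _ D] conjI)
    show "\<forall>W w. openin ?P W \<and> w \<in> W \<longrightarrow> (\<exists>V\<in>D. w \<in> V \<and> V \<subseteq> W)"
      by (intro allI impI) (elim conjE, rule base)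
  qed (use D D_open in auto)
  have open_sets: "W \<in> sets (M \<Otimes>\<^sub>M N)" if "openin ?P W" for W
  proof -
    have "W = \<Union> {V \<in> D. V \<subseteq> W}" using base[OF that] by blast
    moreover have "\<Union> {V \<in> D. V \<subseteq> W} \<in> sets (M \<Otimes>\<^sub>M N)"
    proof (rule sets.countable_Union)
      show "countable {V \<in> D. V \<subseteq> W}" using D by (rule countable_subset[rotated]) blast
      show "{V \<in> D. V \<subseteq> W} \<subseteq> sets (M \<Otimes>\<^sub>M N)"
        using B(2) C(2) openM openN by (auto simp: D_def intro!: pair_measureI)
    qed
    ultimately show ?thesis by simp
  qed
  have top: "topspace ?P = space (M \<Otimes>\<^sub>M N)"
    by (simp add: X(1) Y(1) space_pair_measure)
  define \<Sigma> where "\<Sigma> = sigma (space M \<times> space N) {U. openin ?P U}"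
  have sub: "{U. openin ?P U} \<subseteq> Pow (space M \<times> space N)"
    using openin_subset[of ?P] X(1) Y(1) by auto
  have sets\<Sigma>: "sets \<Sigma> = sigma_sets (space M \<times> space N) {U. openin ?P U}"
    and space\<Sigma>: "space \<Sigma> = space M \<times> space N"
    using sub by (simp_all add: \<Sigma>_def)
  have fst: "fst \<in> measurable \<Sigma> M"
  proof (rule measurable_sigma_sets[OF X(4)])
    fix U assume "U \<in> {U. openin X U}"
    then have U: "openin X U" by simp
    then have "fst -` U \<inter> space \<Sigma> = U \<times> space N"
      using openin_subset[OF U] X(1) by (auto simp: space\<Sigma>)
    moreover have "openin ?P (U \<times> space N)"
      using U openin_topspace[of Y] Y(1) by (auto simp: openin_prod_Times_iff)
    ultimately show "fst -` U \<inter> space \<Sigma> \<in> sets \<Sigma>" by (auto simp: sets\<Sigma>)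
  qed (use openin_subset X(1) space\<Sigma> in auto)
  have snd: "snd \<in> measurable \<Sigma> N"
  proof (rule measurable_sigma_sets[OF Y(4)])
    fix U assume "U \<in> {U. openin Y U}"
    then have U: "openin Y U" by simp
    then have "snd -` U \<inter> space \<Sigma> = space M \<times> U"
      using openin_subset[OF U] Y(1) by (auto simp: space\<Sigma>)
    moreover have "openin ?P (space M \<times> U)"
      using U openin_topspace[of X] X(1) by (auto simp: openin_prod_Times_iff)
    ultimately show "snd -` U \<inter> space \<Sigma> \<in> sets \<Sigma>" by (auto simp: sets\<Sigma>)
  qed (use openin_subset Y(1) space\<Sigma> in auto)
  have "sets (M \<Otimes>\<^sub>M N) = sets \<Sigma>"
  proof
    show "sets \<Sigma> \<subseteq> sets (M \<Otimes>\<^sub>M N)"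
      unfolding sets\<Sigma> using open_sets sets.sigma_sets_subset[of "{U. openin ?P U}" "M \<Otimes>\<^sub>M N"]
      by (auto simp: space_pair_measure)
    show "sets (M \<Otimes>\<^sub>M N) \<subseteq> sets \<Sigma>"
    proof
      fix A assume A: "A \<in> sets (M \<Otimes>\<^sub>M N)"
      have "(\<lambda>w. (fst w, snd w)) \<in> measurable \<Sigma> (M \<Otimes>\<^sub>M N)"
        using fst snd by (rule measurable_Pair)
      from measurable_sets[OF this A] have "A \<inter> space \<Sigma> \<in> sets \<Sigma>"
        by (simp add: vimage_def) 
      moreover have "A \<subseteq> space \<Sigma>"
        using sets.sets_into_space[OF A] by (simp add: space\<Sigma> space_pair_measure)
      ultimately show "A \<in> sets \<Sigma>" by (simp add: Int_absorb2)
    qed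
  qed
  then show ?thesis
    unfolding standard_borel_def
    using top sc completely_metrizable_space_prod_topology[of X Y] X(2) Y(2)
    by (intro exI[of _ ?P]) (simp add: sets\<Sigma> space_pair_measure)
qed

text \<open>The complement of the diagonal is a countable union of boxes \<open>U \<times> V\<close> with disjoint basic
  open sides, because the topology is Hausdorff and second countable.\<close>

lemma standard_borel_diagonal:
  assumes "standard_borel N"
  shows "{w \<in> space (N \<Otimes>\<^sub>M N). fst w = snd w} \<in> sets (N \<Otimes>\<^sub>M N)"
proof -
  obtain Y where Y: "topspace Y = space N" "completely_metrizable_space Y" "second_countable Y"
      "sets N = sigma_sets (space N) {U. openin Y U}"
    using assms by (auto simp: standard_borel_def)
  have haus: "Hausdorff_space Y"
    by (intro metrizable_imp_Hausdorff_space completely_metrizable_imp_metrizable_space Y(2))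
  obtain C where C: "countable C" "\<And>V. V \<in> C \<Longrightarrow> openin Y V"
      "\<And>U x. openin Y U \<Longrightarrow> x \<in> U \<Longrightarrow> \<exists>V\<in>C. x \<in> V \<and> V \<subseteq> U"
    using Y(3) by (auto simp: second_countable_def)
  define E where "E = {(U, V) \<in> C \<times> C. U \<inter> V = {}}"
  have C_sets: "V \<in> sets N" "V \<subseteq> space N" if "V \<in> C" for V
    using C(2)[OF that] Y(4) openin_subset Y(1) by (blast, metis)
  have "{w \<in> space (N \<Otimes>\<^sub>M N). fst w \<noteq> snd w} = (\<Union>(U, V)\<in>E. U \<times> V)"
  proof (intro equalityI subsetI)
    fix w assume "w \<in> {w \<in> space (N \<Otimes>\<^sub>M N). fst w \<noteq> snd w}"
    then obtain x y where w: "w = (x, y)" "x \<in> topspace Y" "y \<in> topspace Y" "x \<noteq> y"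
      by (cases w) (auto simp: space_pair_measure Y(1))
    obtain U V where UV: "openin Y U" "openin Y V" "x \<in> U" "y \<in> V" "U \<inter> V = {}"
      using haus w(2-4) unfolding Hausdorff_space_def disjnt_def by metis
    obtain U' where U': "U' \<in> C" "x \<in> U'" "U' \<subseteq> U" using C(3)[OF UV(1,3)] by blast
    obtain V' where V': "V' \<in> C" "y \<in> V'" "V' \<subseteq> V" using C(3)[OF UV(2,4)] by blast
    have "(U', V') \<in> E" using U' V' UV(5) by (auto simp: E_def)
    then show "w \<in> (\<Union>(U, V)\<in>E. U \<times> V)" using U' V' w(1) by blast
  next
    fix w assume "w \<in> (\<Union>(U, V)\<in>E. U \<times> V)"
    then obtain U V where "(U, V) \<in> E" "w \<in> U \<times> V" by blast
    then show "w \<in> {w \<in> space (N \<Otimes>\<^sub>M N). fst w \<noteq> snd w}"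
      using C_sets(2) by (auto simp: E_def space_pair_measure)
  qed
  also have "\<dots> \<in> sets (N \<Otimes>\<^sub>M N)"
  proof (rule sets.countable_UN')
    show "countable E" using C(1) by (auto simp: E_def intro: countable_subset[of _ "C \<times> C"])
  qed (use C_sets(1) in \<open>auto simp: E_def intro!: pair_measureI\<close>)
  finally have "space (N \<Otimes>\<^sub>M N) - {w \<in> space (N \<Otimes>\<^sub>M N). fst w \<noteq> snd w} \<in> sets (N \<Otimes>\<^sub>M N)"
    by (rule sets.compl_sets)
  moreover have "space (N \<Otimes>\<^sub>M N) - {w \<in> space (N \<Otimes>\<^sub>M N). fst w \<noteq> snd w}
      = {w \<in> space (N \<Otimes>\<^sub>M N). fst w = snd w}" by blast
  ultimately show ?thesis by simp
qed

section \<open>The coupling defined by an orbit equivalence\<close>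

lemma free_imp_inj_on_carrier:
  fixes G (structure)
  assumes "group_action G E \<phi>" "x \<in> E" "\<forall>g\<in>carrier G. g \<noteq> \<one> \<longrightarrow> \<phi> g x \<noteq> x"
  shows "inj_on (\<lambda>g. \<phi> g x) (carrier G)"
proof (rule inj_onI)
  interpret group_action G E \<phi> by fact
  interpret group G using group_hom group_hom.axioms(1) by auto
  fix g h assume gh: "g \<in> carrier G" "h \<in> carrier G" and eq: "\<phi> g x = \<phi> h x"
  have "\<phi> (inv h \<otimes> g) x = \<phi> (inv h) (\<phi> h x)"
    using composition_rule[of x "inv h" g] gh assms(2) eq by simp
  also have "\<dots> = x" using orbit_sym_aux[OF gh(2) assms(2) refl] .
  finally have "inv h \<otimes> g = \<one>" using assms(3) gh by auto
  then show "g = h" using gh inv_equality[of "inv h" g] inv_inv inv_closed by metis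
qed

text \<open>The coupling is built from an orbit equivalence as follows. On \<open>M \<times> N\<close> take the measure that
  counts, above each \<open>x\<close>, the points of the countable set \<open>\<Phi> (G x) = H (\<Phi> x)\<close>, and integrates over \<open>x\<close>.
  The group \<open>G\<close> acts on the first coordinate and \<open>H\<close> on the second, so that both actions are
  defined at every point and commute. Almost every orbit under either group meets the graph of
  \<open>\<Phi>\<close> exactly once, and the two cocycles of the coupling are those of \<open>\<Phi>\<close> and of \<open>\<Psi>\<close>. As \<open>\<Phi>\<close> is only an
  isomorphism up to null sets, everything is checked above the conull set of good points.\<close>

locale orbit_equivalent_actions =
  fixes G :: "('g, 'c) monoid_scheme" and M :: "'a measure" and \<phi> :: "'g \<Rightarrow> 'a \<Rightarrow> 'a"
    and H :: "('h, 'd) monoid_scheme" and N :: "'b measure" and \<psi> :: "'h \<Rightarrow> 'b \<Rightarrow> 'b"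
    and \<Phi> :: "'a \<Rightarrow> 'b" and \<Psi> :: "'b \<Rightarrow> 'a"
  assumes free_G: "free_pmp_action G M \<phi>" and free_H: "free_pmp_action H N \<psi>"
    and oe: "orbit_equivalence G M \<phi> H N \<psi> \<Phi> \<Psi>"
begin

sublocale GA: group_action G "space M" \<phi>
  using free_G by (simp add: free_pmp_action_def mp_action_def)

sublocale HA: group_action H "space N" \<psi>
  using free_H by (simp add: free_pmp_action_def mp_action_def)

sublocale GG: group G
  using GA.group_hom group_hom.axioms(1) by auto

sublocale HG: group H
  using HA.group_hom group_hom.axioms(1) by auto

sublocale PM: prob_space M
  using free_G by (simp add: free_pmp_action_def)

lemma countable_G: "countable (carrier G)" and countable_H: "countable (carrier H)"
  using free_G free_H by (simp_all add: free_pmp_action_def mp_action_def)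

lemma act_G: "g \<in> carrier G \<Longrightarrow> \<phi> g \<in> measurable M M" "g \<in> carrier G \<Longrightarrow> distr M M (\<phi> g) = M"
  and act_H: "h \<in> carrier H \<Longrightarrow> \<psi> h \<in> measurable N N"
  using free_G free_H by (simp_all add: free_pmp_action_def mp_action_def)

lemma closed_G: "g \<in> carrier G \<Longrightarrow> x \<in> space M \<Longrightarrow> \<phi> g x \<in> space M"
  and closed_H: "h \<in> carrier H \<Longrightarrow> y \<in> space N \<Longrightarrow> \<psi> h y \<in> space N"
  using measurable_space[OF act_G(1)] measurable_space[OF act_H] by blast+

lemma iso: "\<Phi> \<in> measurable M N" "\<Psi> \<in> measurable N M" "distr M N \<Phi> = N" "distr N M \<Psi> = M"
    "AE x in M. \<Psi> (\<Phi> x) = x" "AE y in N. \<Phi> (\<Psi> y) = y"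
  and AE_orbit: "AE x in M. \<Phi> ` orbit G \<phi> x = orbit H \<psi> (\<Phi> x)"
  using oe by (simp_all add: orbit_equivalence_def measure_iso_pair_def)

lemmas closed_\<Phi> = measurable_space[OF iso(1)]

text \<open>The almost everywhere statements, collected along whole orbits.\<close>

definition good :: "'a \<Rightarrow> bool" where
  "good x \<longleftrightarrow> x \<in> space M \<and> inj_on (\<lambda>g. \<phi> g x) (carrier G) \<and>
     inj_on (\<lambda>h. \<psi> h (\<Phi> x)) (carrier H) \<and>
     (\<forall>g\<in>carrier G. \<Psi> (\<Phi> (\<phi> g x)) = \<phi> g x) \<and>
     \<Phi> ` orbit G \<phi> x = orbit H \<psi> (\<Phi> x)"

lemma AE_ess_free_H: "AE x in M. \<forall>h\<in>carrier H. h \<noteq> \<one>\<^bsub>H\<^esub> \<longrightarrow> \<psi> h (\<Phi> x) \<noteq> \<Phi> x"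
proof (rule AE_distrD[OF iso(1)])
  show "AE y in distr M N \<Phi>. \<forall>h\<in>carrier H. h \<noteq> \<one>\<^bsub>H\<^esub> \<longrightarrow> \<psi> h y \<noteq> y"
    unfolding iso(3) using free_H by (simp add: free_pmp_action_def ess_free_def)
qed

lemma AE_good: "AE x in M. good x"
proof -
  have "AE x in M. \<forall>g\<in>carrier G. \<Psi> (\<Phi> (\<phi> g x)) = \<phi> g x"
  proof (rule AE_ball_countable'[OF _ countable_G])
    fix g assume g: "g \<in> carrier G"
    show "AE x in M. \<Psi> (\<Phi> (\<phi> g x)) = \<phi> g x"
      by (rule AE_distrD[OF act_G(1)[OF g]]) (unfold act_G(2)[OF g], rule iso(5))
  qed
  moreover have "AE x in M. \<forall>g\<in>carrier G. g \<noteq> \<one>\<^bsub>G\<^esub> \<longrightarrow> \<phi> g x \<noteq> x"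
    using free_G by (simp add: free_pmp_action_def ess_free_def)
  ultimately show ?thesis
    using AE_ess_free_H AE_orbit AE_space[of M]
  proof eventually_elim
    case (elim x)
    then show ?case
      unfolding good_def
      using free_imp_inj_on_carrier[OF GA.group_action_axioms, of x]
        free_imp_inj_on_carrier[OF HA.group_action_axioms closed_\<Phi>, of x] by simp
  qed
qed

lemma good_bij:
  assumes "good x"
  shows "bij_betw (\<lambda>g. \<Phi> (\<phi> g x)) (carrier G) (orbit H \<psi> (\<Phi> x))"
    and "bij_betw (\<lambda>h. \<psi> h (\<Phi> x)) (carrier H) (orbit H \<psi> (\<Phi> x))"
proof -
  have "inj_on (\<lambda>g. \<Phi> (\<phi> g x)) (carrier G)"
    using assms unfolding good_def inj_on_def by metis
  moreover have "(\<lambda>g. \<Phi> (\<phi> g x)) ` carrier G = \<Phi> ` orbit G \<phi> x"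
    by (auto simp: orbit_def)
  ultimately show "bij_betw (\<lambda>g. \<Phi> (\<phi> g x)) (carrier G) (orbit H \<psi> (\<Phi> x))"
    using assms by (simp add: bij_betw_def good_def)
  have "(\<lambda>h. \<psi> h (\<Phi> x)) ` carrier H = orbit H \<psi> (\<Phi> x)"
    by (auto simp: orbit_def)
  then show "bij_betw (\<lambda>h. \<psi> h (\<Phi> x)) (carrier H) (orbit H \<psi> (\<Phi> x))"
    using assms by (simp add: bij_betw_def good_def)
qed

text \<open>Both sides sum \<open>f\<close> over the same set \<open>\<Phi> (G x) = H (\<Phi> x)\<close>, enumerated once by each group. This is
  what makes the measure below invariant under both actions.\<close>

lemma good_sum:
  assumes "good x"
  shows "(\<integral>\<^sup>+g. f (\<Phi> (\<phi> g x)) \<partial>count_space (carrier G)) = (\<integral>\<^sup>+h. f (\<psi> h (\<Phi> x)) \<partial>count_space (carrier H))"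
  using nn_integral_bij_count_space[OF good_bij(1)[OF assms], of f]
    nn_integral_bij_count_space[OF good_bij(2)[OF assms], of f] by simp

definition coupling :: "('a \<times> 'b) measure" where
  "coupling = distr (M \<Otimes>\<^sub>M count_space (carrier G)) (M \<Otimes>\<^sub>M N) (\<lambda>p. (fst p, \<Phi> (\<phi> (snd p) (fst p))))"

lemma space_coupling: "space coupling = space M \<times> space N"
  and sets_coupling [measurable_cong]: "sets coupling = sets (M \<Otimes>\<^sub>M N)"
  by (simp_all add: coupling_def space_pair_measure)

lemma point_measurable:
  "(\<lambda>p. (fst p, \<Phi> (\<phi> (snd p) (fst p)))) \<in> measurable (M \<Otimes>\<^sub>M count_space (carrier G)) (M \<Otimes>\<^sub>M N)"
proof (rule measurable_Pair)
  show "(\<lambda>p. \<Phi> (\<phi> (snd p) (fst p))) \<in> measurable (M \<Otimes>\<^sub>M count_space (carrier G)) N"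
  proof (rule measurable_compose_countable'[where f = "\<lambda>g p. \<Phi> (\<phi> g (fst p))", OF _ measurable_snd countable_G])
    fix g assume "g \<in> carrier G"
    then show "(\<lambda>p. \<Phi> (\<phi> g (fst p))) \<in> measurable (M \<Otimes>\<^sub>M count_space (carrier G)) N"
      by (intro measurable_compose[OF _ iso(1)] measurable_compose[OF measurable_fst act_G(1)])
  qed
qed simp

lemma sigma_finite_count: "sigma_finite_measure (count_space (carrier G))"
  by (rule sigma_finite_measure_count_space_countable[OF countable_G])

lemma fibre_sum_measurable:
  assumes "f \<in> borel_measurable (M \<Otimes>\<^sub>M N)"
  shows "(\<lambda>x. \<integral>\<^sup>+g. f (x, \<Phi> (\<phi> g x)) \<partial>count_space (carrier G)) \<in> borel_measurable M"
  using sigma_finite_measure.borel_measurable_nn_integral_fst[OF sigma_finite_count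
      measurable_compose[OF point_measurable assms]] by simp

lemma nn_integral_coupling:
  assumes f: "f \<in> borel_measurable (M \<Otimes>\<^sub>M N)"
  shows "(\<integral>\<^sup>+w. f w \<partial>coupling) = (\<integral>\<^sup>+x. (\<integral>\<^sup>+g. f (x, \<Phi> (\<phi> g x)) \<partial>count_space (carrier G)) \<partial>M)"
  unfolding coupling_def
  using nn_integral_distr[OF point_measurable, of f] f
    sigma_finite_measure.nn_integral_fst[OF sigma_finite_count measurable_compose[OF point_measurable f]]
  by simp

definition graph :: "'g \<Rightarrow> ('a \<times> 'b) set" where
  "graph k = {w \<in> space (M \<Otimes>\<^sub>M N). snd w = \<Phi> (\<phi> k (fst w))}"

lemma graph_sets:
  assumes "k \<in> carrier G"
  shows "graph k \<in> sets (M \<Otimes>\<^sub>M N)"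
proof -
  have "(\<lambda>w. (snd w, \<Phi> (\<phi> k (fst w)))) \<in> measurable (M \<Otimes>\<^sub>M N) (N \<Otimes>\<^sub>M N)"
    by (intro measurable_Pair measurable_snd measurable_compose[OF _ iso(1)]
        measurable_compose[OF measurable_fst act_G(1)[OF assms]])
  moreover have "{w \<in> space (N \<Otimes>\<^sub>M N). fst w = snd w} \<in> sets (N \<Otimes>\<^sub>M N)"
    using free_H standard_borel_diagonal by (auto simp: free_pmp_action_def)
  ultimately have "(\<lambda>w. (snd w, \<Phi> (\<phi> k (fst w)))) -` {w \<in> space (N \<Otimes>\<^sub>M N). fst w = snd w} \<inter>
      space (M \<Otimes>\<^sub>M N) \<in> sets (M \<Otimes>\<^sub>M N)"
    by (rule measurable_sets)
  also have "(\<lambda>w. (snd w, \<Phi> (\<phi> k (fst w)))) -` {w \<in> space (N \<Otimes>\<^sub>M N). fst w = snd w} \<inter>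
      space (M \<Otimes>\<^sub>M N) = graph k"
    using closed_\<Phi> closed_G[OF assms] by (auto simp: graph_def space_pair_measure)
  finally show ?thesis .
qed

text \<open>This graph contains exactly one of the points counted above a good \<open>x\<close>, because
  \<open>g \<mapsto> \<Phi> (\<phi> g x)\<close> is injective.
  For \<open>k = \<one>\<close> this is the volume of the common fundamental domain; for all \<open>k\<close> together it gives
  \<open>\<sigma>\<close>-finiteness.\<close>

lemma emeasure_graph:
  assumes k: "k \<in> carrier G"
  shows "emeasure coupling (graph k) = 1"
proof -
  have "emeasure coupling (graph k) = (\<integral>\<^sup>+w. indicator (graph k) w \<partial>coupling)"
    using graph_sets[OF k] by (simp add: sets_coupling)
  also have "\<dots> = (\<integral>\<^sup>+x. (\<integral>\<^sup>+g. indicator (graph k) (x, \<Phi> (\<phi> g x)) \<partial>count_space (carrier G)) \<partial>M)"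
    using graph_sets[OF k] by (intro nn_integral_coupling) simp
  also have "\<dots> = (\<integral>\<^sup>+x. 1 \<partial>M)"
  proof (rule nn_integral_cong_AE)
    show "AE x in M. (\<integral>\<^sup>+g. indicator (graph k) (x, \<Phi> (\<phi> g x)) \<partial>count_space (carrier G)) = 1"
      using AE_good
    proof eventually_elim
      case (elim x)
      then have "x \<in> space M" by (simp add: good_def)
      then have "indicator (graph k) (x, \<Phi> (\<phi> g x)) = (indicator {k} g :: ennreal)" if "g \<in> carrier G" for g
        using that k bij_betw_imp_inj_on[OF good_bij(1)[OF elim]] closed_\<Phi> closed_G
        by (auto simp: graph_def space_pair_measure indicator_def inj_on_def)
      then have "(\<integral>\<^sup>+g. indicator (graph k) (x, \<Phi> (\<phi> g x)) \<partial>count_space (carrier G))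
          = (\<integral>\<^sup>+g. indicator {k} g \<partial>count_space (carrier G))"
        by (intro nn_integral_cong) simp
      then show ?case using k by simp
    qed
  qed
  finally show ?thesis using PM.emeasure_space_1 by simp
qed

lemma emeasure_coupling_eq_0:
  assumes W: "W \<in> sets (M \<Otimes>\<^sub>M N)" and AE: "AE x in M. \<forall>g\<in>carrier G. (x, \<Phi> (\<phi> g x)) \<notin> W"
  shows "emeasure coupling W = 0"
proof -
  have "emeasure coupling W = (\<integral>\<^sup>+w. indicator W w \<partial>coupling)"
    using W by (simp add: sets_coupling)
  also have "\<dots> = (\<integral>\<^sup>+x. (\<integral>\<^sup>+g. indicator W (x, \<Phi> (\<phi> g x)) \<partial>count_space (carrier G)) \<partial>M)"
    using W by (intro nn_integral_coupling) simp
  also have "\<dots> = (\<integral>\<^sup>+x. 0 \<partial>M)"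
    using AE by (intro nn_integral_cong_AE)
      (auto elim!: eventually_mono simp: nn_integral_0_iff_AE AE_count_space)
  finally show ?thesis by simp
qed

lemma off_graphs_null:
  "space (M \<Otimes>\<^sub>M N) - (\<Union>g\<in>carrier G. graph g) \<in> sets (M \<Otimes>\<^sub>M N)"
  "emeasure coupling (space (M \<Otimes>\<^sub>M N) - (\<Union>g\<in>carrier G. graph g)) = 0"
proof -
  let ?R = "space (M \<Otimes>\<^sub>M N) - (\<Union>g\<in>carrier G. graph g)"
  show R: "?R \<in> sets (M \<Otimes>\<^sub>M N)"
    by (intro sets.compl_sets sets.countable_UN' countable_G) (auto intro: graph_sets)
  show "emeasure coupling ?R = 0"
    by (rule emeasure_coupling_eq_0[OF R], rule AE_I2)
      (auto simp: graph_def space_pair_measure closed_\<Phi> closed_G)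
qed

text \<open>A null set of \<open>coupling\<close> has to be exhibited although \<open>Q\<close> need not be measurable: the points
  above a null set of \<open>M\<close>, together with those lying on none of the countably many graphs.\<close>

lemma AE_couplingI:
  assumes "AE x in M. \<forall>g\<in>carrier G. Q (x, \<Phi> (\<phi> g x))"
  shows "AE w in coupling. Q w"
proof -
  obtain Z where Z: "{x \<in> space M. \<not> (\<forall>g\<in>carrier G. Q (x, \<Phi> (\<phi> g x)))} \<subseteq> Z" "Z \<in> sets M" "emeasure M Z = 0"
    using assms by (rule AE_E)
  define R where "R = space (M \<Otimes>\<^sub>M N) - (\<Union>g\<in>carrier G. graph g)"
  have ZN: "Z \<times> space N \<in> sets (M \<Otimes>\<^sub>M N)" using Z(2) by (intro pair_measureI) auto
  have R: "R \<in> sets (M \<Otimes>\<^sub>M N)" "emeasure coupling R = 0"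
    using off_graphs_null by (simp_all add: R_def)
  have "AE x in M. x \<notin> Z" using Z(2,3) by (intro AE_not_in) auto
  then have "emeasure coupling (Z \<times> space N) = 0"
    by (intro emeasure_coupling_eq_0[OF ZN]) (auto elim: eventually_mono)
  then have W0: "emeasure coupling (Z \<times> space N \<union> R) = 0"
    using emeasure_subadditive[of "Z \<times> space N" coupling R] ZN R by (simp add: sets_coupling)
  show "AE w in coupling. Q w"
  proof (rule AE_I[OF _ W0])
    show "Z \<times> space N \<union> R \<in> sets coupling" using ZN R(1) by (simp add: sets_coupling)
    show "{w \<in> space coupling. \<not> Q w} \<subseteq> Z \<times> space N \<union> R"
    proof (rule subsetI, rule ccontr)
      fix w assume w: "w \<in> {w \<in> space coupling. \<not> Q w}" and notin: "w \<notin> Z \<times> space N \<union> R"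
      obtain x y where xy: "w = (x, y)" "x \<in> space M" "y \<in> space N"
        using w by (auto simp: space_coupling)
      then have "x \<notin> Z" using notin by simp
      moreover obtain g where g: "g \<in> carrier G" "w \<in> graph g"
        using notin xy by (auto simp: R_def space_pair_measure)
      ultimately have "Q (x, \<Phi> (\<phi> g x))" using Z(1) xy(2) by blast
      then show False using g(2) w xy(1) by (simp add: graph_def)
    qed
  qed
qed

lemma standard_measure_space_coupling: "standard_measure_space coupling"
  unfolding standard_measure_space_def
proof (intro conjI)
  have "standard_borel (M \<Otimes>\<^sub>M N)"
    using free_G free_H by (intro standard_borel_pair) (simp_all add: free_pmp_action_def)
  then show "standard_borel coupling"
    by (simp add: standard_borel_def space_coupling sets_coupling space_pair_measure)
  show "sigma_finite_measure coupling"
  proof (rule sigma_finite_measure.intro)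
    let ?R = "space (M \<Otimes>\<^sub>M N) - (\<Union>g\<in>carrier G. graph g)"
    have R: "?R \<in> sets (M \<Otimes>\<^sub>M N)" "emeasure coupling ?R = 0" by (rule off_graphs_null)+
    have "graph g \<subseteq> space (M \<Otimes>\<^sub>M N)" for g by (auto simp: graph_def)
    then show "\<exists>A. countable A \<and> A \<subseteq> sets coupling \<and> \<Union> A = space coupling \<and> (\<forall>a\<in>A. emeasure coupling a \<noteq> \<infinity>)"
      using countable_G R graph_sets
      by (intro exI[of _ "insert ?R (graph ` carrier G)"])
        (auto simp: sets_coupling emeasure_graph space_coupling space_pair_measure)
  qed
  have "emeasure coupling (graph \<one>\<^bsub>G\<^esub>) \<le> emeasure coupling (space coupling)"
    by (rule emeasure_space)
  then show "emeasure coupling (space coupling) \<noteq> 0"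
    using emeasure_graph[of "\<one>\<^bsub>G\<^esub>"] by auto
qed

definition shift_G :: "'g \<Rightarrow> 'a \<times> 'b \<Rightarrow> 'a \<times> 'b" where
  "shift_G g = (\<lambda>w\<in>space M \<times> space N. (\<phi> g (fst w), snd w))"

definition shift_H :: "'h \<Rightarrow> 'a \<times> 'b \<Rightarrow> 'a \<times> 'b" where
  "shift_H h = (\<lambda>w\<in>space M \<times> space N. (fst w, \<psi> h (snd w)))"

lemma shift_apply:
  "x \<in> space M \<Longrightarrow> y \<in> space N \<Longrightarrow> shift_G g (x, y) = (\<phi> g x, y)"
  "x \<in> space M \<Longrightarrow> y \<in> space N \<Longrightarrow> shift_H h (x, y) = (x, \<psi> h y)"
  by (simp_all add: shift_G_def shift_H_def)

lemma one_act: "x \<in> space M \<Longrightarrow> \<phi> \<one>\<^bsub>G\<^esub> x = x" "y \<in> space N \<Longrightarrow> \<psi> \<one>\<^bsub>H\<^esub> y = y"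
  by (simp_all flip: GA.id_eq_one HA.id_eq_one)

text \<open>The fibrewise form in which the invariance of the measure is checked for both actions.\<close>

lemma distr_eqI_coupling:
  assumes T: "T \<in> measurable (M \<Otimes>\<^sub>M N) (M \<Otimes>\<^sub>M N)"
    and eq: "\<And>A. A \<in> sets (M \<Otimes>\<^sub>M N) \<Longrightarrow>
      (\<integral>\<^sup>+x. (\<integral>\<^sup>+g. indicator A (T (x, \<Phi> (\<phi> g x))) \<partial>count_space (carrier G)) \<partial>M) =
      (\<integral>\<^sup>+x. (\<integral>\<^sup>+g. indicator A (x, \<Phi> (\<phi> g x)) \<partial>count_space (carrier G)) \<partial>M)"
  shows "distr coupling coupling T = coupling"
proof (rule measure_eqI)
  fix A assume "A \<in> sets (distr coupling coupling T)"
  then have A: "A \<in> sets (M \<Otimes>\<^sub>M N)" by (simp add: sets_coupling)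
  have T': "T \<in> measurable coupling coupling"
    using T by (simp add: measurable_cong_sets[OF sets_coupling sets_coupling])
  have "emeasure (distr coupling coupling T) A = (\<integral>\<^sup>+w. indicator A w \<partial>distr coupling coupling T)"
    using A by (simp add: sets_coupling)
  also have "\<dots> = (\<integral>\<^sup>+w. indicator A (T w) \<partial>coupling)"
    using A by (intro nn_integral_distr[OF T']) (simp add: sets_coupling)
  also have "\<dots> = (\<integral>\<^sup>+x. (\<integral>\<^sup>+g. indicator A (T (x, \<Phi> (\<phi> g x))) \<partial>count_space (carrier G)) \<partial>M)"
    using A by (intro nn_integral_coupling measurable_compose[OF T]) simp
  also have "\<dots> = (\<integral>\<^sup>+w. indicator A w \<partial>coupling)"
    unfolding eq[OF A] using A by (intro nn_integral_coupling[symmetric]) simp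
  also have "\<dots> = emeasure coupling A" using A by (simp add: sets_coupling)
  finally show "emeasure (distr coupling coupling T) A = emeasure coupling A" .
qed simp

text \<open>Applying \<open>g\<close> to the first coordinate turns the sum over the fibre of \<open>x\<close> into the sum over the
  fibre of \<open>\<phi> g x\<close>, after the substitution of \<open>k \<otimes> g\<close> for \<open>k\<close>; then \<open>\<phi> g\<close> preserves the measure of \<open>M\<close>.\<close>

lemma mp_action_shift_G: "mp_action G coupling shift_G"
  unfolding mp_action_def
proof (intro conjI ballI)
  show "group_action G (space coupling) shift_G"
    unfolding space_coupling
  proof (rule group_actionI)
    show "group G" ..
    show "shift_G g \<in> extensional (space M \<times> space N)" for g by (simp add: shift_G_def)
  qed (auto simp: shift_apply one_act closed_G GA.composition_rule)
  fix g assume g: "g \<in> carrier G"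
  have "(\<lambda>w. (\<phi> g (fst w), snd w)) \<in> measurable (M \<Otimes>\<^sub>M N) (M \<Otimes>\<^sub>M N)"
    by (intro measurable_Pair measurable_snd measurable_compose[OF measurable_fst act_G(1)[OF g]])
  then have T: "shift_G g \<in> measurable (M \<Otimes>\<^sub>M N) (M \<Otimes>\<^sub>M N)"
    by (rule measurable_cong[THEN iffD2, rotated]) (auto simp: space_pair_measure shift_apply)
  then show "shift_G g \<in> measurable coupling coupling"
    by (simp add: measurable_cong_sets[OF sets_coupling sets_coupling])
  show "distr coupling coupling (shift_G g) = coupling"
  proof (rule distr_eqI_coupling[OF T])
    fix A assume A: "A \<in> sets (M \<Otimes>\<^sub>M N)"
    define F where "F = (\<lambda>x. \<integral>\<^sup>+k. (indicator A (x, \<Phi> (\<phi> k x)) :: ennreal) \<partial>count_space (carrier G))"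
    have F: "F \<in> borel_measurable M"
      unfolding F_def using A by (intro fibre_sum_measurable) simp
    have bij: "bij_betw (\<lambda>k. k \<otimes>\<^bsub>G\<^esub> g) (carrier G) (carrier G)"
      using g by (intro bij_betw_byWitness[where f' = "\<lambda>k. k \<otimes>\<^bsub>G\<^esub> inv\<^bsub>G\<^esub> g"])
        (auto simp: GG.m_assoc)
    have "(\<integral>\<^sup>+k. indicator A (shift_G g (x, \<Phi> (\<phi> k x))) \<partial>count_space (carrier G)) = F (\<phi> g x)"
      if x: "x \<in> space M" for x
    proof -
      have "(\<integral>\<^sup>+k. indicator A (shift_G g (x, \<Phi> (\<phi> k x))) \<partial>count_space (carrier G))
          = (\<integral>\<^sup>+k. indicator A (\<phi> g x, \<Phi> (\<phi> k x)) \<partial>count_space (carrier G))"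
        using x by (intro nn_integral_cong) (simp add: shift_apply closed_\<Phi> closed_G)
      also have "\<dots> = (\<integral>\<^sup>+k. indicator A (\<phi> g x, \<Phi> (\<phi> (k \<otimes>\<^bsub>G\<^esub> g) x)) \<partial>count_space (carrier G))"
        by (rule nn_integral_bij_count_space[OF bij, symmetric])
      also have "\<dots> = F (\<phi> g x)"
        unfolding F_def using x g by (intro nn_integral_cong) (simp add: GA.composition_rule)
      finally show ?thesis .
    qed
    then have "(\<integral>\<^sup>+x. (\<integral>\<^sup>+k. indicator A (shift_G g (x, \<Phi> (\<phi> k x))) \<partial>count_space (carrier G)) \<partial>M)
        = (\<integral>\<^sup>+x. F (\<phi> g x) \<partial>M)"
      by (intro nn_integral_cong) simp
    also have "\<dots> = (\<integral>\<^sup>+x. F x \<partial>distr M M (\<phi> g))"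
      using nn_integral_distr[OF act_G(1)[OF g], of F] F by simp
    finally show "(\<integral>\<^sup>+x. (\<integral>\<^sup>+k. indicator A (shift_G g (x, \<Phi> (\<phi> k x))) \<partial>count_space (carrier G)) \<partial>M) =
        (\<integral>\<^sup>+x. (\<integral>\<^sup>+k. indicator A (x, \<Phi> (\<phi> k x)) \<partial>count_space (carrier G)) \<partial>M)"
      by (simp add: act_G(2)[OF g] F_def)
  qed
qed (rule countable_G)

text \<open>Here each fibre is preserved: enumerated by \<open>H\<close>, its points are merely permuted by a left
  translation.\<close>

lemma mp_action_shift_H: "mp_action H coupling shift_H"
  unfolding mp_action_def
proof (intro conjI ballI)
  show "group_action H (space coupling) shift_H"
    unfolding space_coupling
  proof (rule group_actionI)
    show "group H" ..
    show "shift_H h \<in> extensional (space M \<times> space N)" for h by (simp add: shift_H_def)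
  qed (auto simp: shift_apply one_act closed_H HA.composition_rule)
  fix h assume h: "h \<in> carrier H"
  have "(\<lambda>w. (fst w, \<psi> h (snd w))) \<in> measurable (M \<Otimes>\<^sub>M N) (M \<Otimes>\<^sub>M N)"
    by (intro measurable_Pair measurable_fst measurable_compose[OF measurable_snd act_H[OF h]])
  then have T: "shift_H h \<in> measurable (M \<Otimes>\<^sub>M N) (M \<Otimes>\<^sub>M N)"
    by (rule measurable_cong[THEN iffD2, rotated]) (auto simp: space_pair_measure shift_apply)
  then show "shift_H h \<in> measurable coupling coupling"
    by (simp add: measurable_cong_sets[OF sets_coupling sets_coupling])
  show "distr coupling coupling (shift_H h) = coupling"
  proof (rule distr_eqI_coupling[OF T], rule nn_integral_cong_AE)
    fix A assume A: "A \<in> sets (M \<Otimes>\<^sub>M N)"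
    have bij: "bij_betw (\<lambda>k. h \<otimes>\<^bsub>H\<^esub> k) (carrier H) (carrier H)"
      using h by (intro bij_betw_byWitness[where f' = "\<lambda>k. inv\<^bsub>H\<^esub> h \<otimes>\<^bsub>H\<^esub> k"])
        (auto simp: HG.m_assoc[symmetric])
    show "AE x in M. (\<integral>\<^sup>+k. indicator A (shift_H h (x, \<Phi> (\<phi> k x))) \<partial>count_space (carrier G)) =
        (\<integral>\<^sup>+k. (indicator A (x, \<Phi> (\<phi> k x)) :: ennreal) \<partial>count_space (carrier G))"
      using AE_good
    proof eventually_elim
      case (elim x)
      then have x: "x \<in> space M" by (simp add: good_def)
      have "(\<integral>\<^sup>+k. indicator A (shift_H h (x, \<Phi> (\<phi> k x))) \<partial>count_space (carrier G))
          = (\<integral>\<^sup>+k. indicator A (x, \<psi> h (\<Phi> (\<phi> k x))) \<partial>count_space (carrier G))"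
        using x by (intro nn_integral_cong) (simp add: shift_apply closed_\<Phi> closed_G)
      also have "\<dots> = (\<integral>\<^sup>+k. indicator A (x, \<psi> h (\<psi> k (\<Phi> x))) \<partial>count_space (carrier H))"
        by (rule good_sum[OF elim, of "\<lambda>y. indicator A (x, \<psi> h y)"])
      also have "\<dots> = (\<integral>\<^sup>+k. indicator A (x, \<psi> (h \<otimes>\<^bsub>H\<^esub> k) (\<Phi> x)) \<partial>count_space (carrier H))"
        using x h by (intro nn_integral_cong) (simp add: HA.composition_rule closed_\<Phi>)
      also have "\<dots> = (\<integral>\<^sup>+k. indicator A (x, \<psi> k (\<Phi> x)) \<partial>count_space (carrier H))"
        by (rule nn_integral_bij_count_space[OF bij])
      also have "\<dots> = (\<integral>\<^sup>+k. indicator A (x, \<Phi> (\<phi> k x)) \<partial>count_space (carrier G))"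
        by (rule good_sum[OF elim, of "\<lambda>y. indicator A (x, y)", symmetric])
      finally show ?case .
    qed
  qed
qed (rule countable_H)

lemma ess_free_shift_G: "ess_free G coupling shift_G"
  unfolding ess_free_def
proof (rule AE_couplingI)
  have "AE x in M. \<forall>g\<in>carrier G. g \<noteq> \<one>\<^bsub>G\<^esub> \<longrightarrow> \<phi> g x \<noteq> x"
    using free_G by (simp add: free_pmp_action_def ess_free_def)
  then show "AE x in M. \<forall>k\<in>carrier G. \<forall>g\<in>carrier G. g \<noteq> \<one>\<^bsub>G\<^esub> \<longrightarrow>
      shift_G g (x, \<Phi> (\<phi> k x)) \<noteq> (x, \<Phi> (\<phi> k x))"
    using AE_space[of M] by eventually_elim (auto simp: shift_apply closed_\<Phi> closed_G)
qed

lemma ess_free_shift_H: "ess_free H coupling shift_H"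
  unfolding ess_free_def
proof (rule AE_couplingI)
  have "AE x in M. \<forall>k\<in>carrier G. \<forall>h\<in>carrier H. h \<noteq> \<one>\<^bsub>H\<^esub> \<longrightarrow>
      \<psi> h (\<Phi> (\<phi> k x)) \<noteq> \<Phi> (\<phi> k x)"
  proof (rule AE_ball_countable'[OF _ countable_G])
    fix k assume k: "k \<in> carrier G"
    show "AE x in M. \<forall>h\<in>carrier H. h \<noteq> \<one>\<^bsub>H\<^esub> \<longrightarrow> \<psi> h (\<Phi> (\<phi> k x)) \<noteq> \<Phi> (\<phi> k x)"
      by (rule AE_distrD[OF act_G(1)[OF k]]) (unfold act_G(2)[OF k], rule AE_ess_free_H)
  qed
  then show "AE x in M. \<forall>k\<in>carrier G. \<forall>h\<in>carrier H. h \<noteq> \<one>\<^bsub>H\<^esub> \<longrightarrow>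
      shift_H h (x, \<Phi> (\<phi> k x)) \<noteq> (x, \<Phi> (\<phi> k x))"
    using AE_space[of M] by eventually_elim (auto simp: shift_apply closed_\<Phi> closed_G)
qed

text \<open>As \<open>\<one>\<close> acts trivially, this is the graph of \<open>\<Phi>\<close>.\<close>

abbreviation "D \<equiv> graph \<one>\<^bsub>G\<^esub>"

lemma D_iff: "(x, y) \<in> D \<longleftrightarrow> x \<in> space M \<and> y \<in> space N \<and> y = \<Phi> x"
  by (auto simp: graph_def space_pair_measure one_act)

lemma D_orbit_H:
  assumes "good x" "k \<in> carrier G" "y \<in> orbit H \<psi> (\<Phi> x)" "y = \<Phi> (\<phi> k x)" "g \<in> carrier G"
  shows "D \<inter> orbit H shift_H (\<phi> g x, y) = {(\<phi> g x, \<Phi> (\<phi> g x))}"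
proof -
  have x: "x \<in> space M" using assms(1) by (simp add: good_def)
  have sub: "\<Phi> (\<phi> g x) \<in> orbit H \<psi> (\<Phi> x)"
    using assms(1,5) good_bij(1) by (auto dest: bij_betwE)
  then have "\<Phi> (\<phi> g x) \<in> orbit H \<psi> y"
    using HA.orbit_trans HA.orbit_sym assms(3) x closed_\<Phi> closed_G assms(2,4,5) by metis
  then show ?thesis
    using x closed_\<Phi> closed_G closed_H assms(2,4,5) by (auto simp: orbit_def shift_apply D_iff)
qed

lemma D_orbit_G:
  assumes "good x" "k \<in> carrier G" "y = \<Phi> (\<phi> k x)"
  shows "D \<inter> orbit G shift_G (x, y) = {(\<phi> k x, y)}"
proof -
  have x: "x \<in> space M" using assms(1) by (simp add: good_def)
  have inj: "inj_on (\<lambda>g. \<Phi> (\<phi> g x)) (carrier G)"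
    using good_bij(1)[OF assms(1)] by (rule bij_betw_imp_inj_on)
  show ?thesis
    using x closed_\<Phi> closed_G assms(2,3) by (auto simp: orbit_def shift_apply D_iff inj_on_eq_iff[OF inj])
qed

lemma fundamental_domains:
  "fundamental_domain G coupling shift_G D" "fundamental_domain H coupling shift_H D"
  unfolding fundamental_domain_def
proof (safe)
  show "D \<in> sets coupling" "D \<in> sets coupling"
    using graph_sets[of "\<one>\<^bsub>G\<^esub>"] by (simp_all add: sets_coupling)
  show "AE w in coupling. card (D \<inter> orbit G shift_G w) = 1"
    by (rule AE_couplingI) (use AE_good in eventually_elim, simp add: D_orbit_G)
  show "AE w in coupling. card (D \<inter> orbit H shift_H w) = 1"
  proof (rule AE_couplingI)
    show "AE x in M. \<forall>g\<in>carrier G. card (D \<inter> orbit H shift_H (x, \<Phi> (\<phi> g x))) = 1"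
      using AE_good
    proof eventually_elim
      case (elim x)
      then have "D \<inter> orbit H shift_H (\<phi> \<one>\<^bsub>G\<^esub> x, \<Phi> (\<phi> g x)) = {(\<phi> \<one>\<^bsub>G\<^esub> x, \<Phi> (\<phi> \<one>\<^bsub>G\<^esub> x))}"
        if "g \<in> carrier G" for g
        using that good_bij(1)[OF elim] by (intro D_orbit_H) (auto dest: bij_betwE)
      moreover have "\<phi> \<one>\<^bsub>G\<^esub> x = x" using elim by (simp add: good_def one_act)
      ultimately show ?case by simp
    qed
  qed
qed

lemma me_coupling: "me_coupling G H coupling shift_G shift_H D D"
  unfolding me_coupling_def
proof (intro conjI)
  show "AE w in coupling. \<forall>g\<in>carrier G. \<forall>h\<in>carrier H. shift_G g (shift_H h w) = shift_H h (shift_G g w)"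
    by (rule AE_I2) (auto simp: space_coupling shift_apply closed_G closed_H)
qed (simp_all add: standard_measure_space_coupling mp_action_shift_G mp_action_shift_H
    ess_free_shift_G ess_free_shift_H fundamental_domains emeasure_graph)

text \<open>The measure \<open>coupling\<close> restricted to the graph of \<open>\<Phi>\<close> is the image of \<open>M\<close>. The argument goes
  through simple functions because \<open>F\<close> need not be measurable.\<close>

lemma nn_integral_D_le:
  "(\<integral>\<^sup>+w\<in>D. F w \<partial>coupling) \<le> (\<integral>\<^sup>+x. F (x, \<Phi> x) \<partial>M)"
  unfolding nn_integral_def[of coupling]
proof (rule SUP_least)
  fix s assume "s \<in> {s. simple_function coupling s \<and> s \<le> (\<lambda>w. F w * indicator D w)}"
  then have s: "simple_function coupling s" "\<And>w. s w \<le> F w * indicator D w"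
    by (auto simp: le_fun_def)
  have "s \<in> borel_measurable (M \<Otimes>\<^sub>M N)"
    using borel_measurable_simple_function[OF s(1)] by (simp add: measurable_cong_sets[OF sets_coupling])
  then have "integral\<^sup>S coupling s = (\<integral>\<^sup>+x. (\<integral>\<^sup>+g. s (x, \<Phi> (\<phi> g x)) \<partial>count_space (carrier G)) \<partial>M)"
    using nn_integral_eq_simple_integral[OF s(1)] nn_integral_coupling by simp
  also have "\<dots> \<le> (\<integral>\<^sup>+x. F (x, \<Phi> x) \<partial>M)"
  proof (rule nn_integral_mono_AE)
    show "AE x in M. (\<integral>\<^sup>+g. s (x, \<Phi> (\<phi> g x)) \<partial>count_space (carrier G)) \<le> F (x, \<Phi> x)"
      using AE_good
    proof eventually_elim
      case (elim x)
      then have x: "x \<in> space M" by (simp add: good_def)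
      \<comment> \<open>only the identity contributes a point of the graph of \<open>\<Phi>\<close>\<close>
      have "s (x, \<Phi> (\<phi> g x)) \<le> F (x, \<Phi> x) * indicator {\<one>\<^bsub>G\<^esub>} g" if "g \<in> carrier G" for g
      proof (cases "g = \<one>\<^bsub>G\<^esub>")
        case True
        then show ?thesis
          using s(2)[of "(x, \<Phi> x)"] x by (simp add: one_act D_iff closed_\<Phi>)
      next
        case False
        then have "\<Phi> (\<phi> g x) \<noteq> \<Phi> (\<phi> \<one>\<^bsub>G\<^esub> x)"
          using bij_betw_imp_inj_on[OF good_bij(1)[OF elim]] that GG.one_closed by (auto dest: inj_onD)
        then have "(x, \<Phi> (\<phi> g x)) \<notin> D" using x by (simp add: D_iff one_act)
        then show ?thesis using s(2)[of "(x, \<Phi> (\<phi> g x))"] by simp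
      qed
      then have "(\<integral>\<^sup>+g. s (x, \<Phi> (\<phi> g x)) \<partial>count_space (carrier G))
          \<le> (\<integral>\<^sup>+g. F (x, \<Phi> x) * indicator {\<one>\<^bsub>G\<^esub>} g \<partial>count_space (carrier G))"
        by (intro nn_integral_mono) simp
      also have "\<dots> = F (x, \<Phi> x)" by (subst nn_integral_cmult_indicator) simp_all
      finally show ?case .
    qed
  qed
  finally show "integral\<^sup>S coupling s \<le> (\<integral>\<^sup>+x. F (x, \<Phi> x) \<partial>M)" .
qed

lemma me_cocycle_G:
  assumes x: "good x" and g: "g \<in> carrier G"
  shows "me_cocycle shift_G H shift_H D g (x, \<Phi> x) = oe_cocycle \<phi> H \<psi> \<Phi> g x"
proof -
  have X: "x \<in> space M" using x by (simp add: good_def)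
  have "D \<inter> orbit H shift_H (\<phi> g x, \<Phi> x) = {(\<phi> g x, \<Phi> (\<phi> g x))}"
    using X HA.orbit_refl closed_\<Phi> by (intro D_orbit_H[OF x GG.one_closed _ _ g]) (simp_all add: one_act)
  then have "induced_action shift_G H shift_H D g (x, \<Phi> x) = (\<phi> g x, \<Phi> (\<phi> g x))"
    using X closed_\<Phi> by (simp add: induced_action_def shift_apply)
  then have "me_cocycle shift_G H shift_H D g (x, \<Phi> x) =
      (THE h. h \<in> carrier H \<and> \<psi> h (\<Phi> x) = \<Phi> (\<phi> g x))"
    using X g by (simp add: me_cocycle_def shift_apply closed_\<Phi> closed_G cong: conj_cong)
  then show ?thesis by (simp add: oe_cocycle_def eq_commute)
qed

lemma me_cocycle_H:
  assumes x: "good x" and h: "h \<in> carrier H"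
  shows "me_cocycle shift_H G shift_G D h (x, \<Phi> x) = oe_cocycle \<psi> G \<phi> \<Psi> h (\<Phi> x)"
proof -
  have X: "x \<in> space M" using x by (simp add: good_def)
  have "\<psi> h (\<Phi> x) \<in> orbit H \<psi> (\<Phi> x)" using h by (auto simp: orbit_def)
  then obtain k where k: "k \<in> carrier G" "\<psi> h (\<Phi> x) = \<Phi> (\<phi> k x)"
    using good_bij(1)[OF x] by (auto simp: bij_betw_def)
  have "induced_action shift_H G shift_G D h (x, \<Phi> x) = (\<phi> k x, \<psi> h (\<Phi> x))"
    using D_orbit_G[OF x k(1) refl] X closed_\<Phi> k(2) by (simp add: induced_action_def shift_apply)
  then have "me_cocycle shift_H G shift_G D h (x, \<Phi> x) = (THE g. g \<in> carrier G \<and> \<phi> g x = \<phi> k x)"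
    using X h by (simp add: me_cocycle_def shift_apply closed_\<Phi> closed_H)
  moreover have "\<Psi> (\<psi> h (\<Phi> x)) = \<phi> k x" using x k by (simp add: good_def)
  moreover have "\<Psi> (\<Phi> (\<phi> \<one>\<^bsub>G\<^esub> x)) = \<phi> \<one>\<^bsub>G\<^esub> x" using x unfolding good_def by blast
  then have "\<Psi> (\<Phi> x) = x" using X by (simp add: one_act)
  ultimately show ?thesis by (simp add: oe_cocycle_def eq_commute)
qed

lemma me_integrable_G:
  assumes "oe_integrable \<omega> G M \<phi> H len \<psi> \<Phi>"
  shows "me_integrable \<omega> G H len coupling shift_G shift_H D"
  unfolding me_integrable_def
proof
  fix g assume g: "g \<in> carrier G"
  obtain c where c: "c > 0" "(\<integral>\<^sup>+x. ennreal (\<omega> (len (oe_cocycle \<phi> H \<psi> \<Phi> g x) / c)) \<partial>M) < \<infinity>"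
    using assms g by (auto simp: oe_integrable_def)
  have "(\<integral>\<^sup>+w\<in>D. ennreal (\<omega> (len (me_cocycle shift_G H shift_H D g w) / c)) \<partial>coupling)
      \<le> (\<integral>\<^sup>+x. ennreal (\<omega> (len (me_cocycle shift_G H shift_H D g (x, \<Phi> x)) / c)) \<partial>M)"
    by (rule nn_integral_D_le)
  also have "\<dots> = (\<integral>\<^sup>+x. ennreal (\<omega> (len (oe_cocycle \<phi> H \<psi> \<Phi> g x) / c)) \<partial>M)"
    using AE_good g by (intro nn_integral_cong_AE) (auto elim!: eventually_mono simp: me_cocycle_G)
  finally show "\<exists>c>0. (\<integral>\<^sup>+w\<in>D. ennreal (\<omega> (len (me_cocycle shift_G H shift_H D g w) / c)) \<partial>coupling) < \<infinity>"
    using c by (auto intro: le_less_trans)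
qed

text \<open>The integral is over \<open>M\<close>, while integrability of \<open>\<Psi>\<close> concerns \<open>N\<close>. As the integrand need not
  be measurable, the change of variables is done through \<open>\<Psi>\<close>, where the available inequality points
  the right way.\<close>

lemma me_integrable_H:
  assumes "oe_integrable \<omega> H N \<psi> G len \<phi> \<Psi>"
  shows "me_integrable \<omega> H G len coupling shift_H shift_G D"
  unfolding me_integrable_def
proof
  fix h assume h: "h \<in> carrier H"
  define K where "K c y = ennreal (\<omega> (len (oe_cocycle \<psi> G \<phi> \<Psi> h y) / c))" for c y
  obtain c where c: "c > 0" "(\<integral>\<^sup>+y. K c y \<partial>N) < \<infinity>"
    using assms h by (auto simp: oe_integrable_def K_def)
  have "(\<integral>\<^sup>+w\<in>D. ennreal (\<omega> (len (me_cocycle shift_H G shift_G D h w) / c)) \<partial>coupling)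
      \<le> (\<integral>\<^sup>+x. ennreal (\<omega> (len (me_cocycle shift_H G shift_G D h (x, \<Phi> x)) / c)) \<partial>M)"
    by (rule nn_integral_D_le)
  also have "\<dots> = (\<integral>\<^sup>+x. K c (\<Phi> x) \<partial>M)"
    using AE_good h by (intro nn_integral_cong_AE) (auto elim!: eventually_mono simp: me_cocycle_H K_def)
  also have "\<dots> = (\<integral>\<^sup>+x. K c (\<Phi> x) \<partial>distr N M \<Psi>)" by (simp only: iso(4))
  also have "\<dots> \<le> (\<integral>\<^sup>+y. K c (\<Phi> (\<Psi> y)) \<partial>N)" by (rule nn_integral_distr_le[OF iso(2)])
  also have "\<dots> = (\<integral>\<^sup>+y. K c y \<partial>N)"
    using iso(6) by (intro nn_integral_cong_AE) (auto elim: eventually_mono)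
  finally show "\<exists>c>0. (\<integral>\<^sup>+w\<in>D. ennreal (\<omega> (len (me_cocycle shift_H G shift_G D h w) / c)) \<partial>coupling) < \<infinity>"
    using c by (auto intro: le_less_trans)
qed

end

lemma inj_real_pair_to_real: "\<exists>e :: real \<times> real \<Rightarrow> real. inj e"
proof -
  have "(card_of ((UNIV :: real set) \<times> (UNIV :: real set)), card_of (UNIV :: real set)) \<in> ordIso"
    by (rule card_of_Times_same_infinite) (rule infinite_UNIV_char_0)
  then obtain e :: "real \<times> real \<Rightarrow> real" where "bij_betw e (UNIV \<times> UNIV) UNIV"
    using card_of_ordIso by blast
  then show ?thesis by (auto simp: bij_betw_def)
qed

text \<open>The orbit equivalence lives on spaces of reals, its coupling on pairs of reals; an injection of
  the plane into the line brings the coupling back.\<close>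

theorem integrably_orbit_equivalent_imp_measure_equivalent:
  assumes "integrably_orbit_equivalent \<omega>\<^sub>1 \<omega>\<^sub>2 G len\<^sub>G H len\<^sub>H"
  shows "integrably_measure_equivalent \<omega>\<^sub>1 \<omega>\<^sub>2 G len\<^sub>G H len\<^sub>H"
proof -
  obtain M :: "real measure" and \<phi> and N :: "real measure" and \<psi> \<Phi> \<Psi> where
      act: "free_pmp_action G M \<phi>" "free_pmp_action H N \<psi>" "orbit_equivalence G M \<phi> H N \<psi> \<Phi> \<Psi>"
    and int: "oe_integrable \<omega>\<^sub>1 G M \<phi> H len\<^sub>H \<psi> \<Phi>" "oe_integrable \<omega>\<^sub>2 H N \<psi> G len\<^sub>G \<phi> \<Psi>"
    using assms unfolding integrably_orbit_equivalent_def by blast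
  interpret orbit_equivalent_actions G M \<phi> H N \<psi> \<Phi> \<Psi>
    by unfold_locales (fact act)+
  obtain e :: "real \<times> real \<Rightarrow> real" where e: "inj e" using inj_real_pair_to_real by blast
  show ?thesis
    by (rule integrably_measure_equivalentI[OF e me_coupling me_integrable_G[OF int(1)]
          me_integrable_H[OF int(2)]])
qed

section \<open>Odometers of all ranks on the sequences of bits\<close>

text \<open>The sequence \<open>x\<close> is read as \<open>d\<close> interleaved 2-adic integers; this is the residue modulo \<open>2 ^ J\<close> of
  the one with index \<open>a\<close>.\<close>

definition digits :: "nat \<Rightarrow> nat \<Rightarrow> nat \<Rightarrow> (nat \<Rightarrow> bool) \<Rightarrow> int" where
  "digits d a J x = (\<Sum>j<J. of_bool (x (d * j + a)) * 2 ^ j)"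

text \<open>Addition of \<open>v\<close> to the \<open>d\<close> interleaved 2-adic integers. The bit at place \<open>p div d\<close> of a sum depends
  only on the residue modulo \<open>2 ^ Suc (p div d)\<close>, which makes the infinite carry explicit.\<close>

definition odometer :: "nat \<Rightarrow> (nat \<Rightarrow> int) \<Rightarrow> (nat \<Rightarrow> bool) \<Rightarrow> (nat \<Rightarrow> bool)" where
  "odometer d v x = (\<lambda>p. bit (digits d (p mod d) (Suc (p div d)) x + v (p mod d)) (p div d))"

lemma digits_Suc: "digits d a (Suc J) x = digits d a J x + of_bool (x (d * J + a)) * 2 ^ J"
  by (simp add: digits_def)

lemma digits_bounds: "0 \<le> digits d a J x" "digits d a J x < 2 ^ J"
  by (induction J) (auto simp: digits_Suc digits_def)

lemma take_bit_digits: "take_bit J (digits d a (J + i) x) = digits d a J x"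
proof (induction i)
  case 0
  then show ?case by (simp add: take_bit_int_eq_self digits_bounds)
next
  case (Suc i)
  have "take_bit J ((2::int) ^ (J + i)) = 0"
    by (simp add: take_bit_eq_mod power_add)
  then have "take_bit J (of_bool (x (d * (J + i) + a)) * 2 ^ (J + i) :: int) = 0"
    by simp
  then have "take_bit J (digits d a (J + Suc i) x) = take_bit J (digits d a (J + i) x)"
    by (metis add.right_neutral add_Suc_right digits_Suc take_bit_add take_bit_of_0)
  then show ?case using Suc by simp
qed

lemma bit_digits: "j < J \<Longrightarrow> bit (digits d a J x) j \<longleftrightarrow> x (d * j + a)"
proof -
  assume "j < J"
  then obtain i where "J = Suc j + i" using less_iff_Suc_add by auto
  then have "bit (digits d a J x) j \<longleftrightarrow> bit (digits d a (Suc j) x) j"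
    by (metis bit_take_bit_iff lessI take_bit_digits)
  also have "\<dots> \<longleftrightarrow> x (d * j + a)"
  proof -
    have "digits d a (Suc j) x div 2 ^ j = of_bool (x (d * j + a))"
      using digits_bounds[of d a j x] by (simp add: digits_Suc div_add1_eq)
    then show ?thesis by (simp add: bit_iff_odd)
  qed
  finally show ?thesis .
qed

text \<open>Higher digits of \<open>x\<close> do not influence the \<open>j\<close>-th bit of a sum, so any number \<open>M > j\<close> of digits
  computes it.\<close>

lemma odometer_at:
  assumes "a < d" "j < M"
  shows "odometer d v x (d * j + a) \<longleftrightarrow> bit (digits d a M x + v a) j"
proof -
  obtain i where M: "M = Suc j + i" using assms(2) less_iff_Suc_add by auto
  have "take_bit (Suc j) (digits d a (Suc j) x + v a) = take_bit (Suc j) (digits d a M x + v a)"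
    by (metis M take_bit_add take_bit_digits take_bit_take_bit min.idem)
  then have "bit (digits d a (Suc j) x + v a) j = bit (digits d a M x + v a) j"
    by (metis bit_take_bit_iff lessI)
  moreover have "(d * j + a) div d = j" "(d * j + a) mod d = a"
    using assms(1) by auto
  ultimately show ?thesis unfolding odometer_def by simp
qed

lemma coordinate_cases:
  fixes d p :: nat
  assumes "d > 0"
  obtains j a where "a < d" "p = d * j + a"
  by (rule that[of "p mod d" "p div d"]) (use assms in auto)

text \<open>The odometer is addition modulo each power of two; all algebraic properties follow from this.\<close>

lemma digits_odometer:
  assumes "a < d"
  shows "digits d a J (odometer d v x) = take_bit J (digits d a J x + v a)"
proof (induction J)
  case 0
  then show ?case by (simp add: digits_def)
next
  case (Suc J)
  have "take_bit J (digits d a J x + v a) = take_bit J (digits d a (Suc J) x + v a)"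
    by (metis Suc_eq_plus1 take_bit_add take_bit_digits take_bit_take_bit min.idem)
  then show ?case
    using Suc odometer_at[OF assms lessI[of J], of v x]
    by (simp only: digits_Suc[of d a J "odometer d v x"] take_bit_Suc_from_most) (simp add: add.commute)
qed

lemma odometer_add:
  assumes "d > 0" "\<And>a. a < d \<Longrightarrow> w a = u a + v a"
  shows "odometer d w x = odometer d u (odometer d v x)"
proof
  fix p
  obtain j a where a: "a < d" and p: "p = d * j + a" using coordinate_cases[OF assms(1)] .
  have "take_bit (Suc j) (take_bit (Suc j) (digits d a (Suc j) x + v a) + u a)
      = take_bit (Suc j) (digits d a (Suc j) x + w a)"
    by (simp only: take_bit_eq_mod mod_simps assms(2)[OF a] add.assoc add.commute[of "u a"])
  then have "bit (digits d a (Suc j) (odometer d v x) + u a) j = bit (digits d a (Suc j) x + w a) j"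
    unfolding digits_odometer[OF a] by (metis bit_take_bit_iff lessI)
  then show "odometer d w x p = odometer d u (odometer d v x) p"
    unfolding p using odometer_at[OF a lessI[of j], of w x]
      odometer_at[OF a lessI[of j], of u "odometer d v x"] by blast
qed

lemma odometer_zero:
  assumes "d > 0" "\<And>a. a < d \<Longrightarrow> v a = 0"
  shows "odometer d v x = x"
proof
  fix p
  obtain j a where a: "a < d" and p: "p = d * j + a" using coordinate_cases[OF assms(1)] .
  show "odometer d v x p = x p"
    unfolding p using odometer_at[OF a lessI[of j], of v x] assms(2)[OF a] by (simp add: bit_digits)
qed

text \<open>Two translations that agree at \<open>x\<close> are congruent modulo every power of two, hence equal. So the
  action is free at every point.\<close>

lemma odometer_inj:
  assumes "odometer d u x = odometer d v x" "a < d"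
  shows "u a = v a"
proof (rule ccontr)
  assume "u a \<noteq> v a"
  then have nz: "u a - v a \<noteq> 0" by simp
  \<comment> \<open>a power of two exceeding the difference\<close>
  define J where "J = nat \<bar>u a - v a\<bar>"
  have "take_bit J (digits d a J x + u a) = take_bit J (digits d a J x + v a)"
    using digits_odometer[OF assms(2), of J _ x] assms(1) by metis
  then have "(digits d a J x + u a) mod 2 ^ J = (digits d a J x + v a) mod 2 ^ J"
    by (simp add: take_bit_eq_mod)
  then have "2 ^ J dvd u a - v a"
    by (metis add_diff_cancel_left mod_eq_dvd_iff)
  then have "2 ^ J \<le> \<bar>u a - v a\<bar>" using dvd_imp_le_int[OF nz, of "2 ^ J"] by simp
  moreover have "int J < 2 ^ J" by (rule of_nat_less_two_power)
  ultimately show False unfolding J_def by simp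
qed

text \<open>Carries only travel towards higher places, in every coordinate.\<close>

lemma odometer_prefix:
  assumes "d > 0" "\<forall>p<N. x p = y p"
  shows "\<forall>p<N. odometer d v x p = odometer d v y p"
proof (intro allI impI)
  fix p assume "p < N"
  have "digits d (p mod d) (Suc (p div d)) x = digits d (p mod d) (Suc (p div d)) y"
    unfolding digits_def
  proof (rule sum.cong[OF refl])
    fix j assume "j \<in> {..<Suc (p div d)}"
    then have "d * j \<le> d * (p div d)" by simp
    then have "d * j + p mod d \<le> p" by (metis add_le_mono1 mult_div_mod_eq)
    then show "of_bool (x (d * j + p mod d)) * 2 ^ j = (of_bool (y (d * j + p mod d)) * 2 ^ j :: int)"
      using assms(2) \<open>p < N\<close> by simp
  qed
  then show "odometer d v x p = odometer d v y p" by (simp add: odometer_def)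
qed

text \<open>The quotient by \<open>2 ^ J\<close>, which holds the higher digits, is the same before and after the addition.\<close>

lemma odometer_no_carry:
  assumes "d > 0" "\<forall>a<d. digits d a J x + v a \<in> {0..<2 ^ J}" "d * J \<le> p"
  shows "odometer d v x p = x p"
proof -
  obtain j a where a: "a < d" and p: "p = d * j + a" using coordinate_cases[OF assms(1)] .
  have "J \<le> j"
  proof (rule ccontr)
    assume "\<not> J \<le> j"
    then have "d * Suc j \<le> d * J" by (intro mult_le_mono2) simp
    then show False using p a assms(3) by simp
  qed
  then obtain i where j: "Suc j = J + i" "j = J + (j - J)"
    by (metis le_Suc_ex le_SucI le_add_diff_inverse)
  define D where "D = digits d a (Suc j) x"
  define q where "q = D div 2 ^ J"
  have D: "D = 2 ^ J * q + digits d a J x"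
    unfolding q_def using take_bit_digits[of J d a i x] j D_def
    by (metis mult_div_mod_eq take_bit_eq_mod)
  have "(D + v a) div 2 ^ J = q"
  proof -
    have "D + v a = (digits d a J x + v a) + 2 ^ J * q" by (simp add: D)
    moreover have "(digits d a J x + v a) div 2 ^ J = 0"
      using assms(2) a by (intro div_pos_pos_trivial) auto
    ultimately show ?thesis by (metis div_mult_self2 add_0_right power_eq_0_iff zero_neq_numeral)
  qed
  then have "(D + v a) div 2 ^ j = D div 2 ^ j"
    by (metis q_def j(2) power_add zdiv_zmult2_eq zero_le_numeral zero_le_power)
  then have "bit (D + v a) j = bit D j" by (simp add: bit_iff_odd)
  then show ?thesis
    unfolding p using odometer_at[OF a lessI, of v x j] bit_digits[OF lessI, of d a j x] by (simp add: D_def)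
qed

lemma Zpow_simps:
  "carrier (Zpow d) = (\<Pi>\<^sub>E a\<in>{..<d}. UNIV)"
  "\<one>\<^bsub>Zpow d\<^esub> = (\<lambda>a\<in>{..<d}. 0)"
  "u \<otimes>\<^bsub>Zpow d\<^esub> v = (\<lambda>a\<in>{..<d}. u a + v a)"
  by (simp_all add: Zpow_def)

lemma group_Zpow: "group (Zpow d)"
  by (simp add: Zpow_def)

lemma countable_Zpow: "countable (carrier (Zpow d))"
  unfolding Zpow_simps by (rule countable_PiE) auto

text \<open>Subtracting the first \<open>J\<close> digits coordinatewise gives the translation vector. Together with
  \<open>odometer_no_carry\<close> this identifies the orbits with the classes of eventual equality, whatever the
  rank.\<close>

lemma tail_equal_imp_translate:
  assumes "d > 0" and tail: "\<forall>p\<ge>d * J. x p = y p"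
  shows "\<exists>v\<in>carrier (Zpow d). odometer d v x = y \<and> Zpow_length d v \<le> d * 2 ^ J"
proof (intro bexI conjI)
  define v where "v = (\<lambda>a\<in>{..<d}. digits d a J y - digits d a J x)"
  show "v \<in> carrier (Zpow d)" by (simp add: v_def Zpow_simps)
  have eq: "digits d a (J + i) x + v a = digits d a (J + i) y" if "a < d" for a i
  proof (induction i)
    case 0
    then show ?case using that by (simp add: v_def)
  next
    case (Suc i)
    have "d * J \<le> d * (J + i) + a" by (simp add: distrib_left)
    then have "x (d * (J + i) + a) = y (d * (J + i) + a)" using tail by blast
    then show ?case using Suc by (simp add: digits_Suc)
  qed
  show "odometer d v x = y"
  proof
    fix p
    obtain j a where a: "a < d" and p: "p = d * j + a" using coordinate_cases[OF assms(1)] .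
    have "j < J + Suc j" by simp
    then show "odometer d v x p = y p"
      unfolding p using odometer_at[OF a, of j "J + Suc j" v x] eq[OF a, of "Suc j"] bit_digits by metis
  qed
  have "\<bar>real_of_int (v a)\<bar> \<le> 2 ^ J" if "a < d" for a
  proof -
    have "\<bar>v a\<bar> \<le> 2 ^ J"
      using digits_bounds[of d a J x] digits_bounds[of d a J y] that by (simp add: v_def)
    then show ?thesis by (metis of_int_abs of_int_le_numeral_power_cancel_iff)
  qed
  then have "Zpow_length d v \<le> (\<Sum>a<d. 2 ^ J)"
    unfolding Zpow_length_def by (intro sum_mono) auto
  then show "Zpow_length d v \<le> d * 2 ^ J" by simp
qed

section \<open>Independent fair bits\<close>

definition coin_space :: "(nat \<Rightarrow> bool) measure" where
  "coin_space = Pi\<^sub>M UNIV (\<lambda>_. measure_pmf (bernoulli_pmf (1 / 2)))"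

lemma space_coin [simp]: "space coin_space = UNIV"
  by (simp add: coin_space_def space_PiM)

lemma prob_space_coin: "prob_space coin_space"
  unfolding coin_space_def by (rule prob_space_PiM) (rule measure_pmf.prob_space_axioms)

lemma sets_coordinate: "{x. P (x p)} \<in> sets coin_space"
proof -
  have "(\<lambda>x. x p) -` {b. P b} \<inter> space coin_space \<in> sets coin_space"
    unfolding coin_space_def
    by (rule measurable_sets[OF measurable_component_singleton]) auto
  then show ?thesis by (simp add: vimage_def)
qed

lemma sets_cylinder:
  assumes "finite F"
  shows "{x. \<forall>p\<in>F. x p = s p} \<in> sets coin_space"
proof -
  have "{x \<in> space coin_space. \<forall>p\<in>F. x p = s p} \<in> sets coin_space"
  proof (rule sets.sets_Collect_finite_All[OF _ assms])
    fix p
    show "{x \<in> space coin_space. x p = s p} \<in> sets coin_space"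
      using sets_coordinate[of "\<lambda>b. b = s p" p] by simp
  qed
  then show ?thesis by simp
qed

lemma emeasure_coin_cylinder:
  assumes "finite F"
  shows "emeasure coin_space {x. \<forall>p\<in>F. x p = s p} = ennreal ((1 / 2) ^ card F)"
proof -
  interpret product_prob_space "\<lambda>_::nat. measure_pmf (bernoulli_pmf (1 / 2))" UNIV
    by unfold_locales
  have "emeasure coin_space {x. \<forall>p\<in>F. x p = s p}
      = (\<Prod>p\<in>F. emeasure (measure_pmf (bernoulli_pmf (1 / 2))) {s p})"
    using emeasure_PiM_Collect[of F "\<lambda>p. {s p}"] assms by (simp add: coin_space_def space_PiM)
  also have "\<dots> = (\<Prod>p\<in>F. ennreal (1 / 2))"
  proof (rule prod.cong[OF refl])
    fix p
    show "emeasure (measure_pmf (bernoulli_pmf (1 / 2))) {s p} = ennreal (1 / 2)"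
      by (cases "s p") (simp_all add: emeasure_pmf_single)
  qed
  also have "\<dots> = ennreal ((1 / 2) ^ card F)"
    by (subst prod_constant, subst ennreal_power) auto
  finally show ?thesis .
qed

definition prefix_cylinder :: "nat \<Rightarrow> nat set \<Rightarrow> (nat \<Rightarrow> bool) set" where
  "prefix_cylinder N S = {x. \<forall>p<N. x p \<longleftrightarrow> p \<in> S}"

lemma emeasure_prefix_cylinder:
  "emeasure coin_space (prefix_cylinder N S) = ennreal ((1 / 2) ^ N)"
  using emeasure_coin_cylinder[of "{..<N}" "\<lambda>p. p \<in> S"] by (simp add: prefix_cylinder_def Ball_def)

lemma sets_coin:
  "sets coin_space = sigma_sets UNIV (insert {} (range (\<lambda>(N, S). prefix_cylinder N S)))"
  (is "_ = sigma_sets UNIV ?E")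
proof
  have single: "{x. x p \<in> A} \<in> sigma_sets UNIV ?E" for p and A :: "bool set"
  proof -
    have "{x. x p \<in> A} = \<Union> (prefix_cylinder (Suc p) ` {S. S \<subseteq> {..p} \<and> (p \<in> S) \<in> A})"
    proof (intro equalityI subsetI)
      fix x assume "x \<in> {x. x p \<in> A}"
      then have "x \<in> prefix_cylinder (Suc p) ({q. x q} \<inter> {..p})" "(p \<in> {q. x q} \<inter> {..p}) \<in> A"
        by (auto simp: prefix_cylinder_def)
      then show "x \<in> \<Union> (prefix_cylinder (Suc p) ` {S. S \<subseteq> {..p} \<and> (p \<in> S) \<in> A})"
        by (intro UN_I[of "{q. x q} \<inter> {..p}"]) simp_all
    qed (auto simp: prefix_cylinder_def)
    moreover have "finite {S. S \<subseteq> {..p} \<and> (p \<in> S) \<in> A}" by simp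
    then have "countable (prefix_cylinder (Suc p) ` {S. S \<subseteq> {..p} \<and> (p \<in> S) \<in> A})"
      by (intro countable_finite finite_imageI)
    then have "\<Union> (prefix_cylinder (Suc p) ` {S. S \<subseteq> {..p} \<and> (p \<in> S) \<in> A}) \<in> sigma_sets UNIV ?E"
      by (rule sigma_sets_UNION) auto
    ultimately show ?thesis by simp
  qed
  have "sets coin_space = sigma_sets UNIV {{f. f p \<in> A} | p A. True}"
    unfolding coin_space_def by (simp add: sets_PiM_single)
  also have "\<dots> \<subseteq> sigma_sets UNIV ?E"
    by (rule sigma_sets_mono) (use single in auto)
  finally show "sets coin_space \<subseteq> sigma_sets UNIV ?E" .
  have "prefix_cylinder N S \<in> sets coin_space" for N S
    using sets_cylinder[of "{..<N}" "\<lambda>p. p \<in> S"] by (simp add: prefix_cylinder_def Ball_def)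
  then have "?E \<subseteq> sets coin_space" by auto
  then show "sigma_sets UNIV ?E \<subseteq> sets coin_space"
    using sets.sigma_sets_subset[of ?E coin_space] by simp
qed

text \<open>Such a map permutes the cylinders of each length, and all cylinders of the same length have
  the same measure.\<close>

lemma prefix_isometry_measure_preserving:
  assumes "surj f"
    and iso: "\<And>N x y. (\<forall>p<N. f x p = f y p) \<longleftrightarrow> (\<forall>p<N. x p = y p)"
  shows "f \<in> measurable coin_space coin_space" "distr coin_space coin_space f = coin_space"
proof -
  let ?E = "insert {} (range (\<lambda>(N, S). prefix_cylinder N S))"
  have vimage: "\<exists>S'. f -` prefix_cylinder N S = prefix_cylinder N S'" for N S
  proof -
    obtain x where x: "f x = (\<lambda>p. p \<in> S)" using \<open>surj f\<close> by (metis surjD)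
    have "f -` prefix_cylinder N S = {y. \<forall>p<N. f y p = f x p}"
      by (simp add: prefix_cylinder_def x vimage_def)
    then show ?thesis
      unfolding iso by (intro exI[of _ "{p. x p}"]) (simp add: prefix_cylinder_def)
  qed
  have gen: "A \<in> sets coin_space" if "A \<in> ?E" for A
    unfolding sets_coin using that by (rule sigma_sets.Basic)
  have meas: "f \<in> measurable coin_space coin_space"
  proof (rule measurable_sigma_sets[OF sets_coin])
    fix A assume "A \<in> ?E"
    then have "f -` A \<in> ?E" using vimage by (auto simp: image_iff) metis
    then show "f -` A \<inter> space coin_space \<in> sets coin_space" using gen by simp
  qed auto
  then show "f \<in> measurable coin_space coin_space" .
  show "distr coin_space coin_space f = coin_space"
  proof (rule measure_eqI_generator_eq[where E = ?E and \<Omega> = UNIV and A = "\<lambda>_. UNIV"])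
    have inter: "prefix_cylinder N S \<inter> prefix_cylinder N' S' \<in> ?E" if "N \<le> N'" for N N' S S'
    proof (cases "\<forall>p<N. p \<in> S \<longleftrightarrow> p \<in> S'")
      case True
      then have "prefix_cylinder N S \<inter> prefix_cylinder N' S' = prefix_cylinder N' S'"
        using that by (auto simp: prefix_cylinder_def)
      then show ?thesis by auto
    next
      case False
      then have "prefix_cylinder N S \<inter> prefix_cylinder N' S' = {}"
        using that by (auto simp: prefix_cylinder_def)
      then show ?thesis by auto
    qed
    have "prefix_cylinder N S \<inter> prefix_cylinder N' S' \<in> ?E" for N N' S S'
      using inter[of N N'] inter[of N' N S' S] by (metis Int_commute nle_le)
    then show "Int_stable ?E" by (auto simp: Int_stable_def)
    show "emeasure (distr coin_space coin_space f) A = emeasure coin_space A" if A: "A \<in> ?E" for A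
    proof -
      have "emeasure (distr coin_space coin_space f) A = emeasure coin_space (f -` A)"
        using emeasure_distr[OF meas gen[OF A]] by simp
      also have "\<dots> = emeasure coin_space A"
        using A vimage by (auto simp: emeasure_prefix_cylinder) (metis emeasure_prefix_cylinder)
      finally show ?thesis .
    qed
    have "prefix_cylinder 0 {} = UNIV" by (simp add: prefix_cylinder_def)
    then show "range (\<lambda>_. UNIV) \<subseteq> ?E" by auto
    show "emeasure (distr coin_space coin_space f) UNIV \<noteq> \<infinity>"
      using prob_space.emeasure_space_1[OF prob_space.prob_space_distr[OF prob_space_coin meas]] by simp
  qed (use sets_coin in auto)
qed

text \<open>The event prescribes \<open>J\<close> different bits, so the first \<open>J\<close> digits are uniformly distributed.\<close>

lemma emeasure_digits_eq:
  assumes "d > 0" "s \<in> {0..<2 ^ J}"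
  shows "{x. digits d a J x = s} \<in> sets coin_space"
    and "emeasure coin_space {x. digits d a J x = s} = ennreal ((1 / 2) ^ J)"
proof -
  have s: "take_bit J s = s" using assms(2) by (simp add: take_bit_int_eq_self)
  have iff: "digits d a J x = s \<longleftrightarrow> (\<forall>j<J. x (d * j + a) = bit s j)" for x
  proof
    assume "\<forall>j<J. x (d * j + a) = bit s j"
    then have "take_bit J (digits d a J x) = take_bit J s"
      by (intro bit_eqI) (auto simp: bit_take_bit_iff bit_digits)
    then show "digits d a J x = s" using s by (simp add: take_bit_int_eq_self digits_bounds)
  qed (auto simp: bit_digits)
  define F where "F = (\<lambda>j. d * j + a) ` {..<J}"
  have F: "finite F" "card F = J"
    using assms(1) by (auto simp: F_def card_image inj_on_def)
  have eq: "{x. digits d a J x = s} = {x. \<forall>p\<in>F. x p = bit s ((p - a) div d)}"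
    using assms(1) by (auto simp: iff F_def)
  show "emeasure coin_space {x. digits d a J x = s} = ennreal ((1 / 2) ^ J)"
    unfolding eq using emeasure_coin_cylinder[OF F(1)] F(2) by simp
  show "{x. digits d a J x = s} \<in> sets coin_space"
    unfolding eq by (rule sets_cylinder[OF F(1)])
qed

text \<open>There are only finitely many sets of truth values, and all of them are open. Hence the sequences
  of bits have a countable base as well, and their product and Borel \<open>\<sigma>\<close>-algebras coincide.\<close>

instance bool :: second_countable_topology
proof
  have "open S \<and> generate_topology UNIV S" for S :: "bool set"
    by (auto intro: generate_topology.Basis discrete_topology_class.open_discrete)
  then have "countable (UNIV :: bool set set) \<and> open = generate_topology (UNIV :: bool set set)"
    by (auto simp: fun_eq_iff)
  then show "\<exists>B :: bool set set. countable B \<and> open = generate_topology B" by blast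
qed

lemma standard_borel_coin: "standard_borel coin_space"
  unfolding standard_borel_def
proof (intro exI[of _ "euclidean :: (nat \<Rightarrow> bool) topology"] conjI)
  let ?X = "euclidean :: (nat \<Rightarrow> bool) topology"
  have X: "?X = product_topology (\<lambda>_. euclidean) UNIV" by (simp add: euclidean_product_topology)
  have disc: "(euclidean :: bool topology) = discrete_topology UNIV"
  proof -
    have "open S" for S :: "bool set" by (rule discrete_topology_class.open_discrete)
    then show ?thesis by (simp add: topology_eq)
  qed
  show "topspace ?X = space coin_space" by simp
  show "completely_metrizable_space ?X"
    unfolding X disc
    unfolding completely_metrizable_space_product_topology
    by (simp add: completely_metrizable_space_discrete_topology)
  obtain B :: "(nat \<Rightarrow> bool) set set" where B: "countable B" "topological_basis B"
    using ex_countable_basis by metis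
  show "second_countable ?X"
    unfolding second_countable_def
  proof (intro exI[of _ B] conjI)
    show "\<forall>U x. openin ?X U \<and> x \<in> U \<longrightarrow> (\<exists>V\<in>B. x \<in> V \<and> V \<subseteq> U)"
    proof (intro allI impI)
      fix U x assume "openin ?X U \<and> x \<in> U"
      then have "open U" "x \<in> U" by simp_all
      then obtain V where "V \<in> B" "x \<in> V" "V \<subseteq> U"
        by (rule topological_basisE[OF B(2)])
      then show "\<exists>V\<in>B. x \<in> V \<and> V \<subseteq> U" by (intro bexI conjI)
    qed
    show "\<forall>V\<in>B. openin ?X V" using topological_basis_open[OF B(2)] by simp
  qed (rule B(1))
  have "sets coin_space = sets (Pi\<^sub>M UNIV (\<lambda>_::nat. borel :: bool measure))"
    unfolding coin_space_def by (rule sets_PiM_cong) (simp_all add: sets_borel_eq_count_space)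
  also have "\<dots> = sigma_sets UNIV {U. open U}"
    by (simp add: sets_PiM_equal_borel sets_borel)
  finally show "sets coin_space = sigma_sets (space coin_space) {U. openin ?X U}"
    by simp
qed

text \<open>Invariance of the measure is the isometry property: translation by \<open>v\<close> preserves agreement of
  prefixes, and so does the inverse translation.\<close>

lemma free_pmp_action_odometer:
  assumes "d > 0"
  shows "free_pmp_action (Zpow d) coin_space (odometer d)"
  unfolding free_pmp_action_def
proof (intro conjI)
  show "mp_action (Zpow d) coin_space (odometer d)"
    unfolding mp_action_def
  proof (intro conjI ballI)
    show act: "group_action (Zpow d) (space coin_space) (odometer d)"
    proof (rule group_actionI[OF group_Zpow])
      show "odometer d \<one>\<^bsub>Zpow d\<^esub> x = x" for x
        by (rule odometer_zero[OF assms]) (simp add: Zpow_simps)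
      show "odometer d (u \<otimes>\<^bsub>Zpow d\<^esub> v) x = odometer d u (odometer d v x)" for u v x
        by (rule odometer_add[OF assms]) (simp add: Zpow_simps)
    qed simp_all
    fix v assume v: "v \<in> carrier (Zpow d)"
    interpret group_action "Zpow d" UNIV "odometer d" using act by simp
    have "surj (odometer d v)" using surj_prop[OF v] .
    moreover have "(\<forall>p<K. odometer d v x p = odometer d v y p) \<longleftrightarrow> (\<forall>p<K. x p = y p)" for K x y
    proof
      define u where "u = (\<lambda>a. - v a)"
      have inv: "odometer d u (odometer d v z) = z" for z
        using odometer_add[OF assms, of "\<lambda>_. 0" u v z] odometer_zero[OF assms, of "\<lambda>_. 0" z]
        by (simp add: u_def)
      assume "\<forall>p<K. odometer d v x p = odometer d v y p"
      then show "\<forall>p<K. x p = y p"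
        using odometer_prefix[OF assms, of K "odometer d v x" "odometer d v y" u] by (simp add: inv)
    qed (rule odometer_prefix[OF assms])
    ultimately show "odometer d v \<in> measurable coin_space coin_space"
      "distr coin_space coin_space (odometer d v) = coin_space"
      by (rule prefix_isometry_measure_preserving)+
  qed (rule countable_Zpow)
  have "v = \<one>\<^bsub>Zpow d\<^esub>" if "v \<in> carrier (Zpow d)" "odometer d v x = x" for v x
  proof (rule PiE_ext[of _ "{..<d}" "\<lambda>_. UNIV"])
    fix a assume "a \<in> {..<d}"
    then show "v a = \<one>\<^bsub>Zpow d\<^esub> a"
      using odometer_inj[of d v x "\<lambda>_. 0" a] odometer_zero[OF assms, of "\<lambda>_. 0" x] that(2)
      by (simp add: Zpow_simps)
  qed (use that in \<open>simp_all add: Zpow_simps\<close>)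
  then show "ess_free (Zpow d) coin_space (odometer d)"
    unfolding ess_free_def by (intro AE_I2) blast
qed (simp_all add: standard_borel_coin prob_space_coin)

section \<open>Carries and the length of the cocycle\<close>

text \<open>The event that adding \<open>v\<close> carries (or, for negative entries, borrows) beyond the first \<open>J\<close> digits of
  some coordinate.\<close>

definition carry_event :: "nat \<Rightarrow> (nat \<Rightarrow> int) \<Rightarrow> nat \<Rightarrow> (nat \<Rightarrow> bool) set" where
  "carry_event d v J = {x. \<exists>a<d. digits d a J x + v a \<notin> {0..<2 ^ J}}"

text \<open>In the coordinate \<open>a\<close> at most \<open>\<bar>v a\<bar>\<close> of the \<open>2 ^ J\<close> equally likely values of the first \<open>J\<close> digits
  lead out of the range.\<close>

lemma carry_event_bound:
  assumes "d > 0"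
  shows "carry_event d v J \<in> sets coin_space"
    and "emeasure coin_space (carry_event d v J) \<le> ennreal (Zpow_length d v * (1 / 2) ^ J)"
proof -
  define B where "B = (\<lambda>a. {s \<in> {0..<2 ^ J}. s + v a \<notin> {0..<2 ^ J}})"
  define E where "E = (\<lambda>a. \<Union>s\<in>B a. {x. digits d a J x = s})"
  have finB: "finite (B a)" for a
    unfolding B_def by (rule finite_subset[of _ "{0..<2 ^ J}"]) auto
  have cardB: "card (B a) \<le> nat \<bar>v a\<bar>" for a
  proof (cases "v a \<ge> 0")
    case True
    then have "B a \<subseteq> {2 ^ J - v a..<2 ^ J}" by (auto simp: B_def)
    then show ?thesis using True card_mono[of "{2 ^ J - v a..<2 ^ J}" "B a"] by simp
  next
    case False
    then have "B a \<subseteq> {0..<- v a}" by (auto simp: B_def)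
    then show ?thesis using False card_mono[of "{0..<- v a}" "B a"] by simp
  qed
  have eq: "carry_event d v J = (\<Union>a\<in>{..<d}. E a)"
    using digits_bounds[of d _ J] by (auto simp: carry_event_def E_def B_def)
  have setsE: "E a \<in> sets coin_space" for a
    unfolding E_def by (intro sets.finite_UN finB emeasure_digits_eq(1)[OF assms]) (simp add: B_def)
  show "carry_event d v J \<in> sets coin_space"
    unfolding eq by (intro sets.finite_UN setsE) auto
  have emE: "emeasure coin_space (E a) \<le> ennreal (\<bar>real_of_int (v a)\<bar> * (1 / 2) ^ J)" for a
  proof -
    have "emeasure coin_space (E a) \<le> (\<Sum>s\<in>B a. emeasure coin_space {x. digits d a J x = s})"
      unfolding E_def
      by (intro emeasure_subadditive_finite finB) (auto simp: B_def emeasure_digits_eq(1)[OF assms])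
    also have "\<dots> = (\<Sum>s\<in>B a. ennreal ((1 / 2) ^ J))"
      by (intro sum.cong refl emeasure_digits_eq(2)[OF assms]) (simp add: B_def)
    also have "\<dots> = ennreal (real (card (B a)) * (1 / 2) ^ J)"
      by (simp add: ennreal_mult ennreal_of_nat_eq_real_of_nat)
    also have "\<dots> \<le> ennreal (\<bar>real_of_int (v a)\<bar> * (1 / 2) ^ J)"
      using cardB[of a] by (intro ennreal_leI mult_right_mono) (linarith, simp)
    finally show ?thesis .
  qed
  have "emeasure coin_space (carry_event d v J) \<le> (\<Sum>a<d. emeasure coin_space (E a))"
    unfolding eq by (rule emeasure_subadditive_finite) (use setsE in auto)
  also have "\<dots> \<le> (\<Sum>a<d. ennreal (\<bar>real_of_int (v a)\<bar> * (1 / 2) ^ J))"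
    by (intro sum_mono emE)
  also have "\<dots> = ennreal (Zpow_length d v * (1 / 2) ^ J)"
    by (simp add: Zpow_length_def sum_distrib_right)
  finally show "emeasure coin_space (carry_event d v J) \<le> ennreal (Zpow_length d v * (1 / 2) ^ J)" .
qed

lemma AE_no_carry:
  assumes "d > 0"
  shows "AE x in coin_space. \<exists>J. x \<notin> carry_event d v J"
proof (rule AE_I)
  let ?N = "\<Inter>J. carry_event d v J"
  show "{x \<in> space coin_space. \<not> (\<exists>J. x \<notin> carry_event d v J)} \<subseteq> ?N" by auto
  show N: "?N \<in> sets coin_space"
    using carry_event_bound(1)[OF assms] by (intro sets.countable_INT) auto
  have "emeasure coin_space ?N \<le> ennreal (Zpow_length d v * (1 / 2) ^ J)" for J
    using emeasure_mono[of ?N "carry_event d v J" coin_space] carry_event_bound[OF assms, of v J]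
    by (meson INT_lower UNIV_I order_trans)
  moreover have "(\<lambda>J. ennreal (Zpow_length d v * (1 / 2) ^ J)) \<longlonglongrightarrow> ennreal 0"
    by (intro tendsto_ennrealI tendsto_mult_right_zero LIMSEQ_realpow_zero) auto
  ultimately have "emeasure coin_space ?N \<le> ennreal 0"
    by (intro LIMSEQ_le_const) auto
  then show "emeasure coin_space ?N = 0" by simp
qed

text \<open>Without a carry only positions below \<open>d * J\<close> change, and \<open>d * J div e + 1\<close> digits in each
  of \<open>e\<close> coordinates cover these positions.\<close>

lemma no_carry_imp_translate:
  assumes "d > 0" "e > 0" "x \<notin> carry_event d v J"
  shows "\<exists>h\<in>carrier (Zpow e). odometer e h x = odometer d v x \<and>
    Zpow_length e h \<le> e * 2 ^ (d * J div e + 1)"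
proof -
  have "d * J \<le> e * (d * J div e + 1)"
    using dividend_less_times_div[OF assms(2), of "d * J"] by simp
  then have "\<forall>p\<ge>e * (d * J div e + 1). x p = odometer d v x p"
    using odometer_no_carry[OF assms(1), of J x v] assms(3) by (force simp: carry_event_def)
  from tail_equal_imp_translate[OF assms(2) this] show ?thesis by simp
qed

lemma AE_odometer_orbit_subset:
  assumes "d > 0" "e > 0"
  shows "AE x in coin_space. orbit (Zpow d) (odometer d) x \<subseteq> orbit (Zpow e) (odometer e) x"
proof -
  have "AE x in coin_space. \<forall>v\<in>carrier (Zpow d). \<exists>J. x \<notin> carry_event d v J"
    using AE_no_carry[OF assms(1)] countable_Zpow by (intro AE_ball_countable') auto
  then show ?thesis
  proof eventually_elim
    case (elim x)
    show ?case
    proof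
      fix y assume "y \<in> orbit (Zpow d) (odometer d) x"
      then obtain v where v: "v \<in> carrier (Zpow d)" "y = odometer d v x" by (auto simp: orbit_def)
      then obtain J where "x \<notin> carry_event d v J" using elim by blast
      then obtain h where "h \<in> carrier (Zpow e)" "odometer e h x = odometer d v x"
        using no_carry_imp_translate[OF assms] by blast
      then show "y \<in> orbit (Zpow e) (odometer e) x" unfolding v(2) orbit_def by force
    qed
  qed
qed

lemma odometer_cocycle_eq:
  assumes "h \<in> carrier (Zpow e)" "odometer e h x = odometer d v x"
  shows "oe_cocycle (odometer d) (Zpow e) (odometer e) (\<lambda>x. x) v x = h"
  unfolding oe_cocycle_def
proof (rule the_equality)
  fix h' assume h': "h' \<in> carrier (Zpow e) \<and> odometer d v x = odometer e h' x"
  show "h' = h"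
  proof (rule PiE_ext[of _ "{..<e}" "\<lambda>_. UNIV"])
    fix a assume "a \<in> {..<e}"
    then show "h' a = h a" using odometer_inj[of e h' x h a] h' assms(2) by simp
  qed (use assms(1) h' in \<open>auto simp: Zpow_simps\<close>)
qed (use assms in auto)

text \<open>Let \<open>r = 2 powr (d / e)\<close>. Off the carry event at \<open>J\<close> the cocycle has length at most
  \<open>2 * e * r ^ J\<close>, and this event has probability at most of order \<open>2 ^ (- J)\<close>. Splitting the space according to
  the least \<open>J\<close> without carry bounds the integral by the given series.\<close>

lemma odometer_cocycle_integrable:
  fixes \<omega> :: "real \<Rightarrow> real"
  assumes "d > 0" "e > 0" and \<omega>: "mono \<omega>" "\<And>t. \<omega> t \<ge> 0"
    and sm: "summable (\<lambda>J. \<omega> ((2 powr (d / e)) ^ J) / 2 ^ J)"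
  shows "\<exists>c>0. (\<integral>\<^sup>+x. ennreal (\<omega> (Zpow_length e
      (oe_cocycle (odometer d) (Zpow e) (odometer e) (\<lambda>x. x) v x) / c)) \<partial>coin_space) < \<infinity>"
proof (intro exI conjI)
  define r :: real where "r = 2 powr (d / e)"
  \<comment> \<open>the factor \<open>e\<close> counts coordinates, the factor 2 absorbs the rounding of \<open>d * J / e\<close>\<close>
  define c where "c = 2 * real e"
  show "c > 0" using assms by (simp add: c_def)
  define len where "len = (\<lambda>x. Zpow_length e (oe_cocycle (odometer d) (Zpow e) (odometer e) (\<lambda>x. x) v x))"
  have len: "len x / c \<le> r ^ J" if "x \<notin> carry_event d v J" for x J
  proof -
    obtain h where h: "h \<in> carrier (Zpow e)" "odometer e h x = odometer d v x"
        "Zpow_length e h \<le> e * 2 ^ (d * J div e + 1)"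
      using no_carry_imp_translate[OF assms(1,2) \<open>x \<notin> carry_event d v J\<close>] by blast
    have "len x / c \<le> e * 2 ^ (d * J div e + 1) / c"
      unfolding len_def odometer_cocycle_eq[OF h(1,2)] using h(3) \<open>c > 0\<close> by (intro divide_right_mono) auto
    also have "\<dots> = 2 ^ (d * J div e)" using assms(2) by (simp add: c_def)
    also have "\<dots> = 2 powr real (d * J div e)" by (simp add: powr_realpow)
    also have "\<dots> \<le> 2 powr (d / e * J)"
      using of_nat_div_le_of_nat[where ?'a = real, of "d * J" e] by (intro powr_mono) auto
    also have "\<dots> = r ^ J" unfolding r_def by (simp add: powr_powr flip: powr_realpow)
    finally show ?thesis .
  qed
  \<comment> \<open>If \<open>Suc J\<close> is the least place without carry, then \<open>x\<close> lies in the carry event at \<open>J\<close>, whose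
    summand covers \<open>\<omega> (r ^ Suc J)\<close>; the constant covers the case that the place \<open>0\<close> is already free.\<close>
  define b where "b = (\<lambda>x. ennreal (\<omega> 1) + (\<Sum>J. ennreal (\<omega> (r ^ Suc J)) * indicator (carry_event d v J) x))"
  have bound: "ennreal (\<omega> (len x / c)) \<le> b x" if ex: "\<exists>J. x \<notin> carry_event d v J" for x
  proof -
    define K where "K = (LEAST J. x \<notin> carry_event d v J)"
    have K: "x \<notin> carry_event d v K" unfolding K_def using ex by (rule LeastI_ex)
    have le: "\<omega> (len x / c) \<le> \<omega> (r ^ K)" using \<omega>(1) len[OF K] by (rule monoD)
    show ?thesis
    proof (cases K)
      case 0
      then have "ennreal (\<omega> (len x / c)) \<le> ennreal (\<omega> 1)" using le by (simp add: ennreal_leI)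
      also have "\<dots> \<le> b x" by (simp add: b_def)
      finally show ?thesis .
    next
      case (Suc J)
      then have "x \<in> carry_event d v J" using not_less_Least[of J] K_def by (metis lessI)
      then have "ennreal (\<omega> (len x / c)) \<le> ennreal (\<omega> (r ^ Suc J)) * indicator (carry_event d v J) x"
        using le Suc by (simp add: ennreal_leI)
      also have "\<dots> \<le> (\<Sum>J. ennreal (\<omega> (r ^ Suc J)) * indicator (carry_event d v J) x)"
        using sum_le_suminf[OF summableI, of "{J}"] by simp
      also have "\<dots> \<le> b x" by (simp add: b_def)
      finally show ?thesis .
    qed
  qed
  have [measurable]: "carry_event d v J \<in> sets coin_space" for J
    by (rule carry_event_bound(1)[OF assms(1)])
  have "(\<integral>\<^sup>+x. ennreal (\<omega> (len x / c)) \<partial>coin_space) \<le> (\<integral>\<^sup>+x. b x \<partial>coin_space)"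
    using AE_no_carry[OF assms(1), of v] bound by (intro nn_integral_mono_AE) (auto elim: eventually_mono)
  also have "\<dots> = ennreal (\<omega> 1) * emeasure coin_space UNIV +
      (\<Sum>J. ennreal (\<omega> (r ^ Suc J)) * emeasure coin_space (carry_event d v J))"
    unfolding b_def by (simp add: nn_integral_add nn_integral_suminf nn_integral_cmult)
  also have "(\<Sum>J. ennreal (\<omega> (r ^ Suc J)) * emeasure coin_space (carry_event d v J))
      \<le> (\<Sum>J. ennreal (\<omega> (r ^ Suc J) * (Zpow_length d v * (1 / 2) ^ J)))"
    using carry_event_bound(2)[OF assms(1)] \<omega>(2)
    by (intro suminf_le summableI) (auto simp: ennreal_mult' intro!: mult_left_mono)
  also have "emeasure coin_space UNIV = 1"
    using prob_space.emeasure_space_1[OF prob_space_coin] by simp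
  finally have le: "(\<integral>\<^sup>+x. ennreal (\<omega> (len x / c)) \<partial>coin_space)
      \<le> ennreal (\<omega> 1) + (\<Sum>J. ennreal (\<omega> (r ^ Suc J) * (Zpow_length d v * (1 / 2) ^ J)))"
    by (simp add: add_left_mono)
  have "summable (\<lambda>J. 2 * Zpow_length d v * (\<omega> (r ^ Suc J) / 2 ^ Suc J))"
    using sm unfolding r_def by (intro summable_mult) (subst summable_Suc_iff)
  then have "summable (\<lambda>J. \<omega> (r ^ Suc J) * (Zpow_length d v * (1 / 2) ^ J))"
    by (simp add: power_divide mult_ac)
  moreover have "0 \<le> \<omega> (r ^ Suc J) * (Zpow_length d v * (1 / 2) ^ J)" for J
    using \<omega>(2) by (simp add: Zpow_length_def sum_nonneg)
  ultimately have "(\<Sum>J. ennreal (\<omega> (r ^ Suc J) * (Zpow_length d v * (1 / 2) ^ J))) \<noteq> \<infinity>"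
    unfolding infinity_ennreal_def by (rule ennreal_suminf_neq_top)
  then show "(\<integral>\<^sup>+x. ennreal (\<omega> (Zpow_length e
      (oe_cocycle (odometer d) (Zpow e) (odometer e) (\<lambda>x. x) v x) / c)) \<partial>coin_space) < \<infinity>"
    using le unfolding len_def by (auto simp: less_top[symmetric] top_unique)
qed

section \<open>The logarithmic series\<close>

lemma ilog_Suc_ln: "ilog (Suc j) t = ln (ilog j t)"
  by (simp add: ilog_def)

lemma ilog_le_ilog:
  assumes "\<forall>i\<le>k. ilog i T > 0" "T \<le> t" "j \<le> k"
  shows "ilog j T \<le> ilog j t"
  using assms(3)
proof (induction j)
  case (Suc j)
  then have "0 < ilog j T" "ilog j T \<le> ilog j t" using assms by auto
  then show ?case by (simp add: ilog_Suc_ln)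
qed (use assms in simp)

lemma has_derivative_ilog:
  assumes "\<forall>i\<le>k. ilog i t > 0"
  shows "(ilog k has_real_derivative 1 / (\<Prod>j<k. ilog j t)) (at t)"
  using assms
proof (induction k)
  case 0
  have "ilog 0 = (\<lambda>t. t)" by auto
  then show ?case by simp
next
  case (Suc k)
  then have "ilog k t > 0" by simp
  then have "((\<lambda>t. ln (ilog k t)) has_real_derivative
      1 / (\<Prod>j<k. ilog j t) / ilog k t) (at t)"
    using Suc by (auto intro!: derivative_eq_intros)
  moreover have "ilog (Suc k) = (\<lambda>t. ln (ilog k t))" by (auto simp: ilog_Suc_ln)
  ultimately show ?case by (simp add: mult.commute)
qed

text \<open>The product on the right is what the chain rule produces when \<open>ilog k\<close> is differentiated; this is
  the origin of the denominator \<open>Lambda k\<close>.\<close>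

lemma mult_Lambda: "t * Lambda k t = (\<Prod>j<k. ilog j t) * ilog k t"
proof -
  have "t * Lambda k t = (\<Prod>j\<le>k. ilog j t)"
    unfolding Lambda_def by (simp add: atMost_atLeast0 prod.atLeast_Suc_atMost)
  also have "\<dots> = (\<Prod>j<k. ilog j t) * ilog k t"
    by (simp flip: lessThan_Suc_atMost)
  finally show ?thesis .
qed

lemma has_derivative_ilog_powr:
  assumes "\<forall>i\<le>k. ilog i t > 0"
  shows "((\<lambda>t. ilog k t powr (- \<epsilon>)) has_real_derivative
    - (\<epsilon> * (ilog k t powr (- \<epsilon>) / (t * Lambda k t)))) (at t)"
proof -
  have k: "ilog k t > 0" using assms by simp
  have "((\<lambda>t. ilog k t powr (- \<epsilon>)) has_real_derivative
     (- \<epsilon>) * ilog k t powr (- \<epsilon> - 1) * (1 / (\<Prod>j<k. ilog j t))) (at t)"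
    using DERIV_fun_powr[OF has_derivative_ilog[OF assms] k, of "- \<epsilon>"] by simp
  moreover have "ilog k t powr (- \<epsilon> - 1) = ilog k t powr (- \<epsilon>) / ilog k t"
    using k by (simp add: powr_diff)
  ultimately show ?thesis
    by (simp add: mult_Lambda mult.commute)
qed

text \<open>With \<open>F t = ilog k t powr (- \<epsilon>)\<close>, the general term is \<open>- t * F' t / \<epsilon>\<close> at \<open>t = \<rho> ^ J\<close>, by the preceding
  derivative. As \<open>- F'\<close> decreases, the mean value theorem bounds this term by a constant times
  the decrease of \<open>F\<close> from \<open>\<rho> ^ (J - 1)\<close> to \<open>\<rho> ^ J\<close>, and these decreases telescope.\<close>

lemma summable_varpi_powers:
  assumes adm: "admissible_threshold \<alpha> k \<epsilon> T" and "\<epsilon> > 0" and "\<rho> > 1"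
  shows "summable (\<lambda>J. varpi T \<alpha> k \<epsilon> (\<rho> ^ J) / (\<rho> ^ J) powr \<alpha>)"
proof -
  have posT: "\<forall>i\<le>k. ilog i T > 0" using adm by (simp add: admissible_threshold_def)
  have le: "ilog i s \<le> ilog i t" if "T \<le> s" "s \<le> t" "i \<le> k" for i s t
  proof -
    have "\<forall>i\<le>k. ilog i s > 0" using ilog_le_ilog[OF posT that(1)] posT by force
    then show ?thesis using ilog_le_ilog that by blast
  qed
  have pos: "\<forall>i\<le>k. ilog i t > 0" if "T \<le> t" for t
    using le[OF order_refl that] posT by force
  have T0: "T > 0" using posT by (metis ilog_0 le0)
  define F where "F = (\<lambda>t. ilog k t powr (- \<epsilon>))"
  define w where "w = (\<lambda>t. ilog k t powr (- \<epsilon>) / (t * Lambda k t))"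
  have Lpos: "Lambda k t > 0" if "T \<le> t" for t
    unfolding Lambda_def by (rule prod_pos) (use pos[OF that] in auto)
  have wpos: "w t > 0" if "T \<le> t" for t
    using Lpos[OF that] T0 that pos[OF that] by (auto simp: w_def)
  have wmono: "w t \<le> w s" if "T \<le> s" "s \<le> t" for s t
    unfolding w_def
  proof (rule frac_le)
    show "ilog k t powr (- \<epsilon>) \<le> ilog k s powr (- \<epsilon>)"
      using le[OF that] pos[OF that(1)] \<open>\<epsilon> > 0\<close> by (intro powr_mono2') auto
    have "Lambda k s \<le> Lambda k t"
      unfolding Lambda_def using le[OF that] pos[OF that(1)]
      by (intro prod_mono) (auto intro: less_imp_le)
    then show "s * Lambda k s \<le> t * Lambda k t"
      using that T0 Lpos[OF that(1)] by (intro mult_mono) auto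
    show "0 < s * Lambda k s" using T0 that Lpos[OF that(1)] by auto
  qed auto
  have DF: "(F has_real_derivative - (\<epsilon> * w t)) (at t)" if "T \<le> t" for t
    unfolding F_def w_def by (rule has_derivative_ilog_powr[OF pos[OF that]])
  obtain J0 where J0: "T < \<rho> ^ J0" using real_arch_pow[OF \<open>\<rho> > 1\<close>] by blast
  have big: "T \<le> \<rho> ^ J" if "J0 \<le> J" for J
    using power_increasing[OF that, of \<rho>] J0 \<open>\<rho> > 1\<close> by linarith
  \<comment> \<open>the length of \<open>[\<rho> ^ J, \<rho> ^ Suc J]\<close> is \<open>1 - 1 / \<rho>\<close> times its right end\<close>
  define C where "C = \<epsilon> * (1 - 1 / \<rho>)"
  have "C > 0" using assms by (simp add: C_def)
  have step: "\<rho> ^ Suc J * w (\<rho> ^ Suc J) \<le> (F (\<rho> ^ J) - F (\<rho> ^ Suc J)) / C" if J: "J0 \<le> J" for J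
  proof -
    have lt: "\<rho> ^ J < \<rho> ^ Suc J" using \<open>\<rho> > 1\<close> by simp
    obtain z where z: "z > \<rho> ^ J" "z < \<rho> ^ Suc J"
      "F (\<rho> ^ Suc J) - F (\<rho> ^ J) = (\<rho> ^ Suc J - \<rho> ^ J) * - (\<epsilon> * w z)"
      using MVT2[OF lt, of F "\<lambda>t. - (\<epsilon> * w t)"] DF big[OF J] by force
    have "w (\<rho> ^ Suc J) \<le> w z" using z big[OF J] by (intro wmono) auto
    then have "\<epsilon> * w (\<rho> ^ Suc J) \<le> \<epsilon> * w z" using \<open>\<epsilon> > 0\<close> by simp
    then have "(\<rho> ^ Suc J - \<rho> ^ J) * (\<epsilon> * w (\<rho> ^ Suc J)) \<le> (\<rho> ^ Suc J - \<rho> ^ J) * (\<epsilon> * w z)"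
      by (rule mult_left_mono) (use lt in simp)
    also have "\<dots> = F (\<rho> ^ J) - F (\<rho> ^ Suc J)" using z(3) by linarith
    finally have "(\<rho> ^ Suc J - \<rho> ^ J) * (\<epsilon> * w (\<rho> ^ Suc J)) \<le> F (\<rho> ^ J) - F (\<rho> ^ Suc J)" .
    moreover have "(\<rho> ^ Suc J - \<rho> ^ J) * (\<epsilon> * w (\<rho> ^ Suc J)) = C * (\<rho> ^ Suc J * w (\<rho> ^ Suc J))"
      using \<open>\<rho> > 1\<close> by (simp add: C_def field_simps)
    ultimately have "C * (\<rho> ^ Suc J * w (\<rho> ^ Suc J)) \<le> F (\<rho> ^ J) - F (\<rho> ^ Suc J)"
      by linarith
    then show ?thesis using \<open>C > 0\<close> by (subst pos_le_divide_eq) (auto simp only: mult.commute)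
  qed
  have "decseq (\<lambda>J. F (\<rho> ^ (J + J0)))"
  proof (rule decseq_SucI)
    fix J
    have "0 \<le> \<rho> ^ Suc (J + J0) * w (\<rho> ^ Suc (J + J0))"
      using wpos[OF big[of "Suc (J + J0)"]] \<open>\<rho> > 1\<close> by simp
    then have "0 \<le> (F (\<rho> ^ (J + J0)) - F (\<rho> ^ Suc (J + J0))) / C"
      by (rule order_trans[OF _ step[OF le_add2]])
    then show "F (\<rho> ^ (Suc J + J0)) \<le> F (\<rho> ^ (J + J0))"
      using \<open>C > 0\<close> by (simp add: zero_le_divide_iff)
  qed
  then obtain L where "(\<lambda>J. F (\<rho> ^ (J + J0))) \<longlonglongrightarrow> L"
    using decseq_convergent[of _ 0] by (metis F_def powr_ge_zero)
  then have "summable (\<lambda>J. (F (\<rho> ^ (J + J0)) - F (\<rho> ^ (Suc J + J0))) / C)"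
    by (intro summable_divide telescope_summable')
  then have "summable (\<lambda>J. \<rho> ^ (J + Suc J0) * w (\<rho> ^ (J + Suc J0)))"
  proof (rule summable_comparison_test'[where N = 0])
    fix J
    have "0 \<le> w (\<rho> ^ (J + Suc J0))" using wpos[OF big[of "J + Suc J0"]] by simp
    then show "norm (\<rho> ^ (J + Suc J0) * w (\<rho> ^ (J + Suc J0)))
        \<le> (F (\<rho> ^ (J + J0)) - F (\<rho> ^ (Suc J + J0))) / C"
      using step[of "J + J0"] \<open>\<rho> > 1\<close> by simp
  qed
  moreover have "\<rho> ^ J * w (\<rho> ^ J) = varpi T \<alpha> k \<epsilon> (\<rho> ^ J) / (\<rho> ^ J) powr \<alpha>" if "Suc J0 \<le> J" for J
    using that big[of J] \<open>\<rho> > 1\<close> by (simp add: varpi_def varpi_formula_def w_def)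
  ultimately have "summable (\<lambda>J. varpi T \<alpha> k \<epsilon> (\<rho> ^ (J + Suc J0)) / (\<rho> ^ (J + Suc J0)) powr \<alpha>)"
    by (simp del: add_Suc_right)
  then show ?thesis by (rule summable_iff_shift[THEN iffD1])
qed

lemma varpi_mono:
  assumes "admissible_threshold \<alpha> k \<epsilon> T"
  shows "mono (varpi T \<alpha> k \<epsilon>)"
proof (rule monoI)
  fix s t :: real assume "s \<le> t"
  have "strict_mono_on {T..} (varpi_formula \<alpha> k \<epsilon>)"
    using assms by (simp add: admissible_threshold_def)
  then have le: "varpi_formula \<alpha> k \<epsilon> u \<le> varpi_formula \<alpha> k \<epsilon> v" if "T \<le> u" "u \<le> v" for u v
    using that strict_mono_onD[of "{T..}" "varpi_formula \<alpha> k \<epsilon>" u v] by (cases "u = v") auto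
  show "varpi T \<alpha> k \<epsilon> s \<le> varpi T \<alpha> k \<epsilon> t"
    using \<open>s \<le> t\<close> le[of s t] le[of T t] by (auto simp: varpi_def)
qed

lemma varpi_nonneg:
  assumes "admissible_threshold \<alpha> k \<epsilon> T"
  shows "0 \<le> varpi T \<alpha> k \<epsilon> t"
  using assms by (auto simp: admissible_threshold_def varpi_def intro: less_imp_le)

section \<open>Orbit and measure equivalence of free abelian groups\<close>

text \<open>The exponent is exactly the one for which the two exponential factors cancel:
  \<open>t powr (e / d) = 2 ^ J\<close> at \<open>t = (2 powr (d / e)) ^ J\<close>. What remains is the logarithmic series.\<close>

lemma odometer_varpi_integrable:
  assumes "d > 0" "e > 0" "\<epsilon> > 0" and T: "admissible_threshold (e / d) k \<epsilon> T"
  shows "oe_integrable (varpi T (e / d) k \<epsilon>) (Zpow d) coin_space (odometer d)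
    (Zpow e) (Zpow_length e) (odometer e) (\<lambda>x. x)"
  unfolding oe_integrable_def
proof
  fix v
  define \<rho> :: real where "\<rho> = 2 powr (d / e)"
  have "\<rho> > 1" using assms(1,2) by (simp add: \<rho>_def)
  moreover have "(\<rho> ^ J) powr (e / d) = 2 ^ J" for J
    using assms(1,2) by (simp add: \<rho>_def powr_powr mult.commute flip: powr_realpow)
  ultimately have "summable (\<lambda>J. varpi T (e / d) k \<epsilon> (\<rho> ^ J) / 2 ^ J)"
    using summable_varpi_powers[OF T \<open>\<epsilon> > 0\<close>, of \<rho>] by simp
  then show "\<exists>c>0. (\<integral>\<^sup>+x. ennreal (varpi T (e / d) k \<epsilon> (Zpow_length e
      (oe_cocycle (odometer d) (Zpow e) (odometer e) (\<lambda>x. x) v x) / c)) \<partial>coin_space) < \<infinity>"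
    unfolding \<rho>_def
    by (intro odometer_cocycle_integrable assms(1,2) varpi_mono[OF T] varpi_nonneg[OF T])
qed

lemma inj_bits_to_real: "\<exists>e :: (nat \<Rightarrow> bool) \<Rightarrow> real. inj e"
proof -
  obtain f :: "nat set \<Rightarrow> real" where "bij f"
    using nat_sets_eqpoll_reals by (auto simp: eqpoll_def)
  then have "inj (\<lambda>x :: nat \<Rightarrow> bool. f {p. x p})"
    by (auto simp: inj_def bij_def fun_eq_iff)
  then show ?thesis by blast
qed

lemma integrably_orbit_equivalent_Zpow:
  assumes "n > 0" "m > 0" "\<epsilon> > 0"
    and T: "admissible_threshold (m / n) k \<epsilon> T" and S: "admissible_threshold (n / m) k \<epsilon> S"
  shows "integrably_orbit_equivalent (varpi T (m / n) k \<epsilon>) (varpi S (n / m) k \<epsilon>)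
    (Zpow n) (Zpow_length n) (Zpow m) (Zpow_length m)"
proof -
  obtain e :: "(nat \<Rightarrow> bool) \<Rightarrow> real" where e: "inj e" using inj_bits_to_real by blast
  have "AE x in coin_space. orbit (Zpow n) (odometer n) x = orbit (Zpow m) (odometer m) x"
    using AE_odometer_orbit_subset[OF assms(1,2)] AE_odometer_orbit_subset[OF assms(2,1)]
    by eventually_elim (rule equalityI)
  then show ?thesis
    using assms by (intro integrably_orbit_equivalentI[OF e, of _ coin_space "odometer n" _ "odometer m"]
        free_pmp_action_odometer odometer_varpi_integrable)
qed

theorem proposition1p5:
  fixes n m k :: nat and \<epsilon> :: real and T :: "real \<Rightarrow> nat \<Rightarrow> real \<Rightarrow> real"
  assumes T: "\<And>\<alpha> k' \<epsilon>'. \<alpha> > 0 \<Longrightarrow> k' \<ge> 1 \<Longrightarrow> \<epsilon>' > 0 \<Longrightarrow>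
      admissible_threshold \<alpha> k' \<epsilon>' (T \<alpha> k' \<epsilon>')"
    and "n > 0" and "m > 0" and "\<epsilon> > 0" and "k \<ge> 1"
  shows "integrably_orbit_equivalent
           (varpi (T (m / n) k \<epsilon>) (m / n) k \<epsilon>) (varpi (T (n / m) k \<epsilon>) (n / m) k \<epsilon>)
           (Zpow n) (Zpow_length n) (Zpow m) (Zpow_length m)
       \<and> integrably_measure_equivalent
           (varpi (T (m / n) k \<epsilon>) (m / n) k \<epsilon>) (varpi (T (n / m) k \<epsilon>) (n / m) k \<epsilon>)
           (Zpow n) (Zpow_length n) (Zpow m) (Zpow_length m)"
proof -
  have adm: "admissible_threshold (m / n) k \<epsilon> (T (m / n) k \<epsilon>)"
      "admissible_threshold (n / m) k \<epsilon> (T (n / m) k \<epsilon>)"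
    using assms by (intro T; simp)+
  from integrably_orbit_equivalent_Zpow[OF \<open>n > 0\<close> \<open>m > 0\<close> \<open>\<epsilon> > 0\<close> adm]
  show ?thesis using integrably_orbit_equivalent_imp_measure_equivalent by blast
qed

end
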